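(* Let $N\ge 3$. Let $\alpha$ be a positive continuous function in ${\mathbb R}^N\setminus\{0\}$ such that $\limsup_{|x|\to 0}|x|^{-a}\alpha(x)<\infty$ and $\limsup_{|x|\to\infty}|x|^{-b}\alpha(x)<\infty$ for some $a>-2$ and $b\in{\mathbb R}$. Let $1<p<r\le\infty$ and $c,d\in{\mathbb R}$ be such that $$p>\frac{N+b}{N-2},\qquad r>\frac{N(p-1)}{2},\qquad c>-\frac{a+2}{p-1},\qquad d<-\frac{b+2}{p-1}.$$ Let $\mu$ be a nontrivial nonnegative Radon measure in ${\mathbb R}^N$ satisfying $\Gamma*\mu\in L^r_{c,d}$. For $\kappa>0$ consider the problem $$(\mathrm{P}_\kappa)\qquad -\Delta u=\alpha(x)u^p+\kappa\mu\ \mbox{ in }{\mathbb R}^N,\qquad u>0\ \mbox{ in }{\mathbb R}^N,\qquad u(x)\to0\ \mbox{ as }|x|\to\infty.$$ Then there exists $\kappa^*>0$ (with $\kappa^*<\infty$) such that (1) if $0<\kappa<\kappa^*$, then problem $(\mathrm{P}_\kappa)$ possesses a minimal solution $u^\kappa$; (2) if $\kappa>\kappa^*$, then problem $(\mathrm{P}_\kappa)$ possesses no solutions. Furthermore, there exists $\kappa_*\in(0,\kappa^*]$ such that (3) if $0<\kappa<\kappa_*$, then $u^\kappa\in L^r_{c_*,d_*}$ with $c_*:=\min\{c,0\}$ and $d_*:=\max\{d,-N+2\}$.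
   Context: Let $B(0,R)=\{y\in{\mathbb R}^N:|y|<R\}$ and $A(0,R)=B(0,R)\setminus B(0,R/2)$ for $R>0$. $\Gamma(x)=\frac{1}{N(N-2)\omega_N}|x|^{-N+2}$, where $\omega_N$ is the volume of $B(0,1)$, and $(\Gamma*\mu)(x)=\int_{{\mathbb R}^N}\Gamma(x-y)\,d\mu(y)$. For $q\in[1,\infty]$ and $\beta,\gamma\in{\mathbb R}$, $L^q_{\beta,\gamma}$ is the set of $f\in L^q_{\rm loc}({\mathbb R}^N\setminus\{0\})$ with $$\|f\|_{L^q_{\beta,\gamma}}:=\sup_{R>0}R^{-N/q}\frac{\|f\|_{L^q(A(0,R))}}{\omega_{\beta,\gamma}(R)}<\infty,$$ where $\omega_{\beta,\gamma}(R)=R^\beta$ for $R\in(0,1]$ and $\omega_{\beta,\gamma}(R)=R^\gamma$ for $R\in(1,\infty)$. Solutions to $(\mathrm{P}_\kappa)$ are understood as follows: a nonnegative, measurable function $u$ in ${\mathbb R}^N$, finite and positive almost everywhere, is a solution to $(\mathrm{P}_\kappa)$ if $$u(x)=\int_{{\mathbb R}^N}\Gamma(x-y)\alpha(y)u(y)^p\,dy+\kappa\int_{{\mathbb R}^N}\Gamma(x-y)\,d\mu(y)\quad\mbox{for a.a. }x\in{\mathbb R}^N.$$ A solution $u$ is a minimal solution if, for any solution $v$ to $(\mathrm{P}_\kappa)$, $u(x)\le v(x)$ for a.a. $x\in{\mathbb R}^N$; a minimal solution is unique if it exists. *)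

theory Defs
  imports "HOL-Analysis.Analysis" "HOL-Probability.Essential_Supremum"
begin

text \<open>
  The space \<open>\<real>\<^sup>N\<close> is an arbitrary Euclidean space \<open>'a\<close> with \<open>N = DIM('a)\<close>.  Solutions and potentials
  are \<open>[0, \<infinity>]\<close>-valued, so every integral below exists and a function may be infinite on a null set.
\<close>

text \<open>Powers on \<open>[0, \<infinity>]\<close>, meant for exponents \<open>s > 0\<close>.\<close>

definition ennpowr :: "ennreal \<Rightarrow> real \<Rightarrow> ennreal" where
  "ennpowr t s = (if t = \<infinity> then \<infinity> else ennreal (enn2real t powr s))"

subsection \<open>The weighted spaces\<close>

text \<open>
  Functions on \<open>S\<close> take extended real values.  The exponent \<open>q\<close> ranges over \<open>[1, \<infinity>]\<close>.
\<close>

definition Lq_norm :: "ereal \<Rightarrow> 'a::euclidean_space set \<Rightarrow> ('a \<Rightarrow> ereal) \<Rightarrow> ennreal" where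
  "Lq_norm q S f =
    (if q = \<infinity> then esssup (lebesgue_on S) (\<lambda>x. e2ennreal \<bar>f x\<bar>)
     else ennpowr (\<integral>\<^sup>+x. ennpowr (e2ennreal \<bar>f x\<bar>) (real_of_ereal q) \<partial>lebesgue_on S)
            (1 / real_of_ereal q))"

definition Lq_loc_punctured :: "ereal \<Rightarrow> ('a::euclidean_space \<Rightarrow> ereal) set" where
  "Lq_loc_punctured q =
    {f. f \<in> borel_measurable (lebesgue_on (- {0})) \<and>
        (\<forall>K. compact K \<and> K \<subseteq> - {0} \<longrightarrow> Lq_norm q K f < \<infinity>)}"

definition annulus :: "real \<Rightarrow> 'a::euclidean_space set" where
  "annulus R = ball 0 R - ball 0 (R / 2)"

definition weight :: "real \<Rightarrow> real \<Rightarrow> real \<Rightarrow> real" where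
  "weight \<beta> \<gamma> R = (if R \<le> 1 then R powr \<beta> else R powr \<gamma>)"

text \<open>For \<open>q = \<infinity>\<close> the exponent \<open>N / q\<close>, computed in the extended reals, is \<open>0\<close>.\<close>

definition weighted_norm :: "ereal \<Rightarrow> real \<Rightarrow> real \<Rightarrow> ('a::euclidean_space \<Rightarrow> ereal) \<Rightarrow> ennreal" where
  "weighted_norm q \<beta> \<gamma> f =
    (SUP R\<in>{0<..}. ennreal (R powr (- real_of_ereal (ereal (real DIM('a)) / q)))
       * (Lq_norm q (annulus R) f / ennreal (weight \<beta> \<gamma> R)))"

definition weighted_Lq :: "ereal \<Rightarrow> real \<Rightarrow> real \<Rightarrow> ('a::euclidean_space \<Rightarrow> ereal) set" where
  "weighted_Lq q \<beta> \<gamma> = {f \<in> Lq_loc_punctured q. weighted_norm q \<beta> \<gamma> f < \<infinity>}"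

subsection \<open>Radon measures and Newtonian potentials\<close>

definition radon_measure :: "'a::euclidean_space measure \<Rightarrow> bool" where
  "radon_measure \<mu> \<longleftrightarrow>
    sets \<mu> = sets borel \<and>
    (\<forall>K. compact K \<longrightarrow> emeasure \<mu> K < \<infinity>) \<and>
    (\<forall>A\<in>sets borel. emeasure \<mu> A = (SUP K\<in>{K. K \<subseteq> A \<and> compact K}. emeasure \<mu> K))"

text \<open>
  The kernel is infinite at the origin, which matters when \<open>\<mu>\<close> has atoms; the real power
  would give \<open>0 powr (2 - N) = 0\<close> there.
\<close>

definition newton_kernel :: "'a::euclidean_space \<Rightarrow> ennreal" where
  "newton_kernel x =
    (if x = 0 then \<infinity>
     else ennreal (1 / (real DIM('a) * (real DIM('a) - 2) * measure lebesgue (ball (0::'a) 1))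
                   * norm x powr (2 - real DIM('a))))"

definition newton_potential :: "'a::euclidean_space measure \<Rightarrow> 'a \<Rightarrow> ennreal" where
  "newton_potential \<mu> x = (\<integral>\<^sup>+y. newton_kernel (x - y) \<partial>\<mu>)"

subsection \<open>Solutions\<close>

text \<open>
  Solutions of \<open>-\<Delta>u = \<alpha> u\<^sup>p + \<kappa> \<mu>\<close> with \<open>u > 0\<close> and \<open>u \<rightarrow> 0\<close> at infinity, understood through the
  integral equation.  The value of \<open>\<alpha>\<close> at the origin is irrelevant.
\<close>

definition is_solution ::
  "('a::euclidean_space \<Rightarrow> real) \<Rightarrow> real \<Rightarrow> 'a measure \<Rightarrow> real \<Rightarrow> ('a \<Rightarrow> ennreal) \<Rightarrow> bool" where
  "is_solution \<alpha> p \<mu> \<kappa> u \<longleftrightarrow>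
    u \<in> borel_measurable lebesgue \<and>
    (AE x in lebesgue. 0 < u x \<and> u x < \<infinity>) \<and>
    (AE x in lebesgue.
       u x = (\<integral>\<^sup>+y. newton_kernel (x - y) * ennreal (\<alpha> y) * ennpowr (u y) p \<partial>lebesgue)
             + ennreal \<kappa> * newton_potential \<mu> x)"

definition is_minimal_solution ::
  "('a::euclidean_space \<Rightarrow> real) \<Rightarrow> real \<Rightarrow> 'a measure \<Rightarrow> real \<Rightarrow> ('a \<Rightarrow> ennreal) \<Rightarrow> bool" where
  "is_minimal_solution \<alpha> p \<mu> \<kappa> u \<longleftrightarrow>
    is_solution \<alpha> p \<mu> \<kappa> u \<and>
    (\<forall>v. is_solution \<alpha> p \<mu> \<kappa> v \<longrightarrow> (AE x in lebesgue. u x \<le> v x))"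

end

theory Submission
  imports Defs
begin

text \<open>
  Write \<open>g = \<Gamma> * \<mu>\<close>.  The exponent conditions on \<open>r\<close>, \<open>c\<close> and \<open>d\<close> ensure that \<open>\<alpha> g\<^bsup>p-1\<^esup>\<close> has a bounded
  Newtonian potential: on each dyadic annulus this is Young's inequality, and the contributions of the
  annuli form two geometric series.  By the 3G inequality
  \<open>\<Gamma>(x - y) \<Gamma>(y - z) \<le> C \<Gamma>(x - z) (\<Gamma>(x - y) + \<Gamma>(y - z))\<close> it follows that \<open>\<Gamma> * (\<alpha> g\<^sup>p) \<le> C g\<close> pointwise, so
  \<open>2 \<kappa> g\<close> is a supersolution for small \<open>\<kappa>\<close>.  Monotone iteration below it gives the minimal solution, which is
  at most \<open>g\<close> and hence lies in every weighted space containing \<open>g\<close>.  A solution for \<open>\<kappa>'\<close> is a supersolution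
  for every \<open>\<kappa> < \<kappa>'\<close>, so the admissible \<open>\<kappa>\<close> form an interval.  It is bounded because integrating the
  equation over a fixed annulus \<open>A\<close> bounds \<open>I = \<integral>\<^sub>A u\<^sup>p\<close> below by a constant times \<open>\<kappa>\<^bsup>p-1\<^esup> I\<close>, while \<open>0 < I < \<infinity>\<close>.
\<close>

subsection \<open>Powers of extended nonnegative numbers\<close>

lemma ennpowr_ennreal: "0 \<le> x \<Longrightarrow> ennpowr (ennreal x) s = ennreal (x powr s)"
  by (simp add: ennpowr_def)

lemma ennpowr_top [simp]: "ennpowr \<infinity> s = \<infinity>" "ennpowr top s = top"
  by (simp_all add: ennpowr_def)

lemma ennpowr_zero [simp]: "ennpowr 0 s = 0"
  by (simp add: ennpowr_def)

lemma ennpowr_mono: "0 \<le> s \<Longrightarrow> x \<le> y \<Longrightarrow> ennpowr x s \<le> ennpowr y s"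
  by (cases x; cases y) (auto simp: ennpowr_ennreal top_unique intro!: ennreal_leI powr_mono2)

lemma ennpowr_ennpowr: "ennpowr (ennpowr x s) t = ennpowr x (s * t)"
  by (cases x) (auto simp: ennpowr_ennreal powr_powr)

lemma ennpowr_one [simp]: "ennpowr x 1 = x"
  by (cases x) (auto simp: ennpowr_ennreal)

lemma ennpowr_add:
  assumes "0 < s" "0 < t"
  shows "ennpowr x (s + t) = ennpowr x s * ennpowr x t"
  using assms by (cases x) (auto simp: ennpowr_ennreal powr_add ennreal_mult)

lemma ennpowr_mult:
  assumes "0 < s"
  shows "ennpowr (x * y) s = ennpowr x s * ennpowr y s"
proof -
  \<comment> \<open>Because \<open>0 * top = 0\<close>, a product with one infinite factor is
    infinite only if the other factor is nonzero; taking powers must preserve that.\<close>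
  have pos: "ennpowr z s \<noteq> 0" if "z \<noteq> 0" for z
    using that assms by (cases z) (auto simp: ennpowr_ennreal)
  show ?thesis
    using pos[of x] pos[of y]
    by (cases x; cases y)
      (auto simp: ennpowr_ennreal powr_mult ennreal_mult ennreal_top_mult ennreal_mult_top
            simp flip: ennreal_mult)
qed

lemma ennpowr_measurable [measurable (raw)]:
  assumes [measurable]: "f \<in> borel_measurable M"
  shows "(\<lambda>x. ennpowr (f x) s) \<in> borel_measurable M"
  unfolding ennpowr_def by measurable

text \<open>For \<open>s > 0\<close> the power map is an order isomorphism of [0, \<infinity>] whose
  inverse is the power \<open>1 / s\<close>, so it commutes with suprema.\<close>

lemma ennpowr_SUP:
  fixes f :: "'i \<Rightarrow> ennreal"
  assumes "0 < s"
  shows "ennpowr (SUP i\<in>I. f i) s = (SUP i\<in>I. ennpowr (f i) s)" (is "_ = ?S")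
proof (rule antisym)
  have "f i \<le> ennpowr ?S (1 / s)" if "i \<in> I" for i
  proof -
    have "ennpowr (ennpowr (f i) s) (1 / s) \<le> ennpowr ?S (1 / s)"
      using assms that by (intro ennpowr_mono SUP_upper) auto
    then show ?thesis
      using assms by (simp add: ennpowr_ennpowr)
  qed
  then have "ennpowr (SUP i\<in>I. f i) s \<le> ennpowr (ennpowr ?S (1 / s)) s"
    using assms by (intro ennpowr_mono SUP_least) auto
  then show "ennpowr (SUP i\<in>I. f i) s \<le> ?S"
    using assms by (simp add: ennpowr_ennpowr)
  show "?S \<le> ennpowr (SUP i\<in>I. f i) s"
    using assms by (intro SUP_least ennpowr_mono SUP_upper) auto
qed

text \<open>Young's inequality for the conjugate exponents \<open>r / (r - q)\<close> and
  \<open>r / q\<close>, with both constants relaxed to 1: whichever of \<open>u\<close> and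
  \<open>v powr (r - q)\<close> is larger absorbs the whole product.\<close>

lemma powr_times_le_powr_add_powr:
  fixes u v q r :: real
  assumes "0 \<le> u" "0 \<le> v" "0 < q" "q < r"
  shows "u * v powr q \<le> u powr (r / (r - q)) + v powr r"
proof (cases "u \<le> v powr (r - q)")
  case True
  have "u * v powr q \<le> v powr (r - q) * v powr q"
    using True by (intro mult_right_mono) auto
  also have "\<dots> = v powr r" by (simp flip: powr_add)
  finally show ?thesis by (smt (verit) powr_ge_zero)
next
  case False
  then have u: "0 < u" using powr_ge_zero[of v "r - q"] by linarith
  have "v = (v powr (r - q)) powr (1 / (r - q))"
    using assms by (simp add: powr_powr)
  also have "\<dots> \<le> u powr (1 / (r - q))"
    using False assms by (intro powr_mono2) auto
  finally have "v powr q \<le> (u powr (1 / (r - q))) powr q"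
    using assms by (intro powr_mono2) auto
  then have "u * v powr q \<le> u powr 1 * u powr (q / (r - q))"
    using u by (intro mult_mono) (auto simp: powr_powr)
  also have "\<dots> = u powr (r / (r - q))"
    unfolding powr_add[symmetric] using assms by (simp add: field_simps)
  finally show ?thesis by (smt (verit) powr_ge_zero)
qed

text \<open>The previous inequality applied to \<open>L * u\<close> and \<open>v / G\<close>. Here
  \<open>G\<close> stands for the typical size of \<open>y\<close>, and \<open>L\<close> is a free
  scale that later balances the two terms.\<close>

lemma ennreal_times_ennpowr_le:
  assumes "0 < q" "q < r" "0 < L" "0 < G"
  shows "x * ennpowr y q \<le>
    ennreal (G powr q * L powr (q / (r - q))) * ennpowr x (r / (r - q)) +
    ennreal (G powr (q - r) / L) * ennpowr y r"
proof -
  \<comment> \<open>With positive coefficients, an infinite argument makes the right-hand side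
    infinite.\<close>
  have pos: "0 < ennreal (G powr q * L powr (q / (r - q)))" "0 < ennreal (G powr (q - r) / L)"
    using assms by auto
  show ?thesis
  proof (cases "x = top \<or> y = top")
    case True
    then show ?thesis using pos by (auto simp: ennreal_mult_top)
  next
    case False
    then obtain u v where uv: "x = ennreal u" "y = ennreal v" "0 \<le> u" "0 \<le> v"
      by (cases x; cases y) auto
    have eq: "L powr (r / (r - q)) = L * L powr (q / (r - q))"
    proof -
      have "r / (r - q) = 1 + q / (r - q)" using assms by (simp add: field_simps)
      then show ?thesis using assms by (simp only: powr_add powr_one)
    qed
    have "u * v powr q = G powr q / L * ((L * u) * (v / G) powr q)"
      using assms uv by (simp add: powr_divide)
    also have "\<dots> \<le> G powr q / L * ((L * u) powr (r / (r - q)) + (v / G) powr r)"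
      using assms uv by (intro mult_left_mono powr_times_le_powr_add_powr) auto
    also have "\<dots> = G powr q * L powr (q / (r - q)) * u powr (r / (r - q)) + G powr (q - r) / L * v powr r"
      using assms uv by (simp add: powr_divide powr_mult powr_diff eq field_simps)
    finally show ?thesis
      using uv assms by (simp add: ennpowr_ennreal ennreal_leI flip: ennreal_mult ennreal_plus)
  qed
qed

subsection \<open>The Newtonian kernel\<close>

text \<open>The estimates below use only the power law and a positive constant, so the normalisation
  is hidden here; its positivity rests on \<open>N > 2\<close>.\<close>

lemma newton_kernel_formula:
  assumes "DIM('a::euclidean_space) \<ge> 3"
  obtains C where "C > 0"
    "\<And>x::'a. x \<noteq> 0 \<Longrightarrow> newton_kernel x = ennreal (C * norm x powr (2 - real DIM('a)))"
proof
  have "0 < measure lebesgue (ball (0::'a) 1)"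
    by (simp add: content_ball_pos)
  then show "1 / (real DIM('a) * (real DIM('a) - 2) * measure lebesgue (ball (0::'a) 1)) > 0"
    using assms by (intro divide_pos_pos mult_pos_pos) auto
qed (simp add: newton_kernel_def)

lemma newton_kernel_0 [simp]: "newton_kernel 0 = top"
  by (simp add: newton_kernel_def)

lemma newton_kernel_measurable [measurable (raw)]:
  assumes [measurable]: "f \<in> borel_measurable M"
  shows "(\<lambda>x. newton_kernel (f x)) \<in> borel_measurable M"
  unfolding newton_kernel_def by measurable

lemma newton_kernel_commute: "newton_kernel (x - y) = newton_kernel (y - x)"
  by (simp add: newton_kernel_def norm_minus_commute)

lemma newton_kernel_antimono:
  fixes x y :: "'a::euclidean_space"
  assumes "DIM('a) \<ge> 3" "norm x \<le> norm y"
  shows "newton_kernel y \<le> newton_kernel x"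
proof (cases "x = 0")
  case False
  then have "y \<noteq> 0" using assms by auto
  obtain C where C: "C > 0" "\<And>x::'a. x \<noteq> 0 \<Longrightarrow> newton_kernel x = ennreal (C * norm x powr (2 - real DIM('a)))"
    using newton_kernel_formula[OF assms(1)] by metis
  show ?thesis
    unfolding C(2)[OF False] C(2)[OF \<open>y \<noteq> 0\<close>]
    using C(1) assms False by (intro ennreal_leI mult_left_mono powr_mono2') auto
qed auto

text \<open>Homogeneity of degree \<open>2 - N\<close>. Combined with antimonotonicity it compares
  kernels at points whose norms are ordered only up to the factor 2.\<close>

lemma newton_kernel_half:
  fixes x :: "'a::euclidean_space"
  assumes "DIM('a) \<ge> 3"
  shows "newton_kernel (x /\<^sub>R 2) = ennreal (2 powr (real DIM('a) - 2)) * newton_kernel x"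
proof (cases "x = 0")
  case False
  obtain C where C: "C > 0" "\<And>x::'a. x \<noteq> 0 \<Longrightarrow> newton_kernel x = ennreal (C * norm x powr (2 - real DIM('a)))"
    using newton_kernel_formula[OF assms(1)] by metis
  have "(norm x / 2) powr (2 - real DIM('a)) = 2 powr (real DIM('a) - 2) * norm x powr (2 - real DIM('a))"
    by (simp add: powr_divide powr_diff)
  moreover have "norm (x /\<^sub>R 2) = norm x / 2" by simp
  moreover have "x /\<^sub>R 2 \<noteq> 0" using False by simp
  ultimately have "newton_kernel (x /\<^sub>R 2) =
    ennreal (2 powr (real DIM('a) - 2) * (C * norm x powr (2 - real DIM('a))))"
    by (simp only: C(2) not_False_eq_True mult.left_commute)
  then show ?thesis
    using C(1) by (simp only: C(2)[OF False] ennreal_mult' powr_ge_zero)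
qed (simp add: ennreal_mult_top)

text \<open>By the triangle inequality the larger of the two distances is at least half of
  \<open>norm (x - z)\<close>, so its kernel is at most a constant times
  \<open>newton_kernel (x - z)\<close>. The kernel of the other distance survives and is one of the
  two summands.\<close>

lemma newton_kernel_3G:
  fixes x y z :: "'a::euclidean_space"
  assumes "DIM('a) \<ge> 3"
  shows "newton_kernel (x - y) * newton_kernel (y - z) \<le>
    ennreal (2 powr (real DIM('a) - 2)) * newton_kernel (x - z) *
      (newton_kernel (x - y) + newton_kernel (y - z))"
proof -
  have half: "newton_kernel w \<le> ennreal (2 powr (real DIM('a) - 2)) * newton_kernel v"
    if "norm v \<le> 2 * norm w" for v w :: 'a
    unfolding newton_kernel_half[OF assms, symmetric]
    using that by (intro newton_kernel_antimono assms) simp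
  have "norm (x - z) \<le> norm (x - y) + norm (y - z)"
    using norm_triangle_ineq[of "x - y" "y - z"] by simp
  then consider "norm (x - z) \<le> 2 * norm (x - y)" | "norm (x - z) \<le> 2 * norm (y - z)"
    by linarith
  then show ?thesis
  proof cases
    case 1
    have "newton_kernel (x - y) * newton_kernel (y - z)
        \<le> (ennreal (2 powr (real DIM('a) - 2)) * newton_kernel (x - z)) * newton_kernel (y - z)"
      by (intro mult_right_mono half 1) auto
    also have "\<dots> \<le> (ennreal (2 powr (real DIM('a) - 2)) * newton_kernel (x - z)) *
      (newton_kernel (x - y) + newton_kernel (y - z))"
      by (intro mult_left_mono) auto
    finally show ?thesis .
  next
    case 2
    have "newton_kernel (y - z) * newton_kernel (x - y)
        \<le> (ennreal (2 powr (real DIM('a) - 2)) * newton_kernel (x - z)) * newton_kernel (x - y)"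
      by (intro mult_right_mono half 2) auto
    also have "\<dots> \<le> (ennreal (2 powr (real DIM('a) - 2)) * newton_kernel (x - z)) *
      (newton_kernel (x - y) + newton_kernel (y - z))"
      by (intro mult_left_mono) auto
    finally show ?thesis by (simp only: mult.commute[of "newton_kernel (y - z)"])
  qed
qed

section \<open>Measurability of potentials of Radon measures\<close>

lemma radon_measure_sigma_finite:
  assumes "radon_measure \<mu>"
  shows "sigma_finite_measure \<mu>"
proof
  have s: "sets \<mu> = sets borel" "space \<mu> = UNIV"
    using assms sets_eq_imp_space_eq[of \<mu> borel] by (auto simp: radon_measure_def)
  show "\<exists>A. countable A \<and> A \<subseteq> sets \<mu> \<and> \<Union> A = space \<mu> \<and> (\<forall>a\<in>A. emeasure \<mu> a \<noteq> \<infinity>)"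
  proof (intro exI[of _ "range (\<lambda>n::nat. cball 0 (real n))"] conjI ballI)
    show "\<Union> (range (\<lambda>n::nat. cball 0 (real n))) = space \<mu>"
      unfolding s using real_arch_simple by auto
    show "emeasure \<mu> K \<noteq> \<infinity>" if "K \<in> range (\<lambda>n::nat. cball 0 (real n))" for K
      using that assms by (auto simp: radon_measure_def top.not_eq_extremum)
  qed (auto simp: s)
qed

lemma newton_potential_measurable [measurable]:
  fixes \<mu> :: "'a::euclidean_space measure"
  assumes "radon_measure \<mu>"
  shows "newton_potential \<mu> \<in> borel_measurable borel"
proof -
  interpret sigma_finite_measure \<mu> by (rule radon_measure_sigma_finite[OF assms])
  have [measurable_cong]: "sets \<mu> = sets borel" using assms by (simp add: radon_measure_def)
  show ?thesis unfolding newton_potential_def[abs_def] by measurable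
qed

subsection \<open>Minimal solutions and nonexistence\<close>

text \<open>The nonlinear term of the integral equation, taken over \<open>lborel\<close> so that
  Borel measurability and Tonelli apply directly. Completion changes neither integrals nor null
  sets, hence \<open>is_solution_iff\<close>.\<close>

definition newton_op :: "('a::euclidean_space \<Rightarrow> real) \<Rightarrow> real \<Rightarrow> ('a \<Rightarrow> ennreal) \<Rightarrow> 'a \<Rightarrow> ennreal" where
  "newton_op \<alpha> p u x = (\<integral>\<^sup>+y. newton_kernel (x - y) * ennreal (\<alpha> y) * ennpowr (u y) p \<partial>lborel)"

lemma is_solution_iff:
  "is_solution \<alpha> p \<mu> \<kappa> u \<longleftrightarrow>
    u \<in> borel_measurable lebesgue \<and>
    (AE x in lborel. 0 < u x \<and> u x < \<infinity>) \<and>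
    (AE x in lborel. u x = newton_op \<alpha> p u x + ennreal \<kappa> * newton_potential \<mu> x)"
  by (simp add: is_solution_def newton_op_def nn_integral_completion AE_completion_iff)

lemma newton_op_mono_AE:
  assumes "AE y in lborel. u y \<le> v y" "0 \<le> p"
  shows "newton_op \<alpha> p u x \<le> newton_op \<alpha> p v x"
  unfolding newton_op_def using assms(1)
  by (intro nn_integral_mono_AE) (auto elim!: eventually_mono intro!: mult_left_mono ennpowr_mono assms)

lemma newton_op_measurable [measurable]:
  assumes [measurable]: "\<alpha> \<in> borel_measurable borel" "u \<in> borel_measurable borel"
  shows "newton_op \<alpha> p u \<in> borel_measurable borel"
  unfolding newton_op_def[abs_def] by measurable

text \<open>Some closed ball around the origin has positive mass, and seen from bounded
  \<open>x\<close> the kernel is bounded below on that ball.\<close>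

lemma newton_potential_pos_lower_bound:
  fixes \<mu> :: "'a::euclidean_space measure"
  assumes "DIM('a) \<ge> 3" "radon_measure \<mu>" "emeasure \<mu> (space \<mu>) \<noteq> 0"
  obtains g0 :: real where "g0 > 0" "\<And>x. norm x \<le> B \<Longrightarrow> ennreal g0 \<le> newton_potential \<mu> x"
proof -
  have s: "sets \<mu> = sets borel" "space \<mu> = UNIV"
    using assms(2) sets_eq_imp_space_eq[of \<mu> borel] by (auto simp: radon_measure_def)
  have un: "(\<Union>n. cball 0 (real n)) = (UNIV :: 'a set)"
    using real_arch_simple by auto
  have "\<exists>n. emeasure \<mu> (cball 0 (real n)) \<noteq> 0"
  proof (rule ccontr)
    assume "\<not> ?thesis"
    then have "(\<Union>n. cball 0 (real n)) \<in> null_sets \<mu>"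
      by (intro null_sets_UN) (auto simp: null_sets_def s)
    then show False using assms(3) by (simp add: un s null_setsD1)
  qed
  then obtain n where n: "emeasure \<mu> (cball 0 (real n)) \<noteq> 0" by auto
  \<comment> \<open>Only the norm of \<open>e\<close> matters: it exceeds every distance between a
    point of norm at most \<open>B\<close> and a point of the charged ball.\<close>
  obtain e :: 'a where e: "norm e = \<bar>B\<bar> + real n + 1"
    using vector_choose_size[of "\<bar>B\<bar> + real n + 1"] by auto
  have "newton_kernel e \<noteq> 0"
  proof -
    have "e \<noteq> 0" using e by auto
    moreover obtain C where "C > 0" "\<And>x::'a. x \<noteq> 0 \<Longrightarrow> newton_kernel x = ennreal (C * norm x powr (2 - real DIM('a)))"
      using newton_kernel_formula[OF assms(1)] by metis
    ultimately show ?thesis by (simp add: not_le)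
  qed
  then have "0 < newton_kernel e * emeasure \<mu> (cball 0 (real n))"
    using n by (simp add: zero_less_iff_neq_zero)
  then obtain t where t: "0 < t" "t < newton_kernel e * emeasure \<mu> (cball 0 (real n))"
    using dense by blast
  then obtain g0 where "t = ennreal g0" by (cases t) auto
  with t have g0: "0 < g0" "ennreal g0 < newton_kernel e * emeasure \<mu> (cball 0 (real n))"
    by auto
  show ?thesis
  proof
    fix x :: 'a assume x: "norm x \<le> B"
    have "newton_kernel e * emeasure \<mu> (cball 0 (real n)) = (\<integral>\<^sup>+y. newton_kernel e * indicator (cball 0 (real n)) y \<partial>\<mu>)"
      by (simp add: nn_integral_cmult_indicator s)
    also have "\<dots> \<le> newton_potential \<mu> x"
      unfolding newton_potential_def
    proof (intro nn_integral_mono)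
      fix y
      have "norm (x - y) \<le> norm e" if "norm y \<le> real n"
        using norm_triangle_ineq4[of x y] e x that by auto
      then show "newton_kernel e * indicator (cball 0 (real n)) y \<le> newton_kernel (x - y)"
        by (auto simp: indicator_def intro!: newton_kernel_antimono assms)
    qed
    finally show "ennreal g0 \<le> newton_potential \<mu> x" using g0 by auto
  qed (rule g0)
qed

text \<open>Iterating the right-hand side \<open>F\<close> of the equation from 0 gives an
  increasing sequence whose supremum is a fixed point. It lies below every \<open>w\<close> with
  \<open>F w \<le> w\<close> a.e.; the choice \<open>w = v\<close> yields finiteness, and arbitrary
  solutions \<open>w\<close> yield minimality.\<close>

lemma minimal_solution_below_supersolution:
  fixes \<mu> :: "'a::euclidean_space measure"
  assumes "DIM('a) \<ge> 3" "radon_measure \<mu>" "emeasure \<mu> (space \<mu>) \<noteq> 0"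
    and [measurable]: "\<alpha> \<in> borel_measurable borel" and "1 < p" "0 < \<kappa>"
    and fin: "AE x in lborel. v x < \<infinity>"
    and super: "AE x in lborel. newton_op \<alpha> p v x + ennreal \<kappa> * newton_potential \<mu> x \<le> v x"
  obtains u where "is_minimal_solution \<alpha> p \<mu> \<kappa> u" "AE x in lborel. u x \<le> v x"
proof -
  note [measurable] = newton_potential_measurable[OF assms(2)]
  define F where "F = (\<lambda>u x. newton_op \<alpha> p u x + ennreal \<kappa> * newton_potential \<mu> x)"
  define U where "U = (\<lambda>n. (F ^^ n) (\<lambda>_. 0))"
  define u where "u = (\<lambda>x. SUP n. U n x)"
  have U_simps: "U 0 = (\<lambda>_. 0)" "\<And>n. U (Suc n) = F (U n)"
    by (simp_all add: U_def)
  \<comment> \<open>Since \<open>F\<close> integrates its argument, an a.e. inequality between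
    arguments becomes an inequality at every point.\<close>
  have F_mono: "F f x \<le> F h x" if "AE y in lborel. f y \<le> h y" for f h x
    unfolding F_def using that assms by (intro add_mono newton_op_mono_AE) auto
  have U_meas [measurable]: "U n \<in> borel_measurable borel" for n
    by (induction n) (simp_all add: U_simps F_def)
  have U_step: "U n x \<le> U (Suc n) x" for n x
  proof (induction n arbitrary: x)
    case (Suc n)
    then show ?case unfolding U_simps(2) by (intro F_mono) (auto simp flip: U_simps(2))
  qed (simp add: U_simps)
  then have U_inc: "incseq (\<lambda>n. U n x)" for x by (intro incseq_SucI)
  have below: "AE x in lborel. u x \<le> w x" if "AE x in lborel. F w x \<le> w x" for w
  proof -
    have "AE x in lborel. U n x \<le> w x" for n
    proof (induction n)
      case (Suc n)
      have "AE x in lborel. F (U n) x \<le> F w x"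
        by (intro AE_I2 F_mono Suc)
      with that show ?case unfolding U_simps(2) by eventually_elim (rule order_trans)
    qed (simp add: U_simps)
    then have "AE x in lborel. \<forall>n. U n x \<le> w x" by (simp add: AE_all_countable)
    then show ?thesis unfolding u_def by eventually_elim (auto intro: SUP_least)
  qed
  have u_meas [measurable]: "u \<in> borel_measurable borel" unfolding u_def by measurable
  have u_fix: "u x = F u x" for x
  proof -
    \<comment> \<open>Monotone convergence, with the supremum first moved inside the power and the
      product.\<close>
    have "newton_op \<alpha> p u x = (SUP n. newton_op \<alpha> p (U n) x)"
    proof -
      have "newton_op \<alpha> p u x = (\<integral>\<^sup>+y. (SUP n. newton_kernel (x - y) * ennreal (\<alpha> y) * ennpowr (U n y) p) \<partial>lborel)"
        unfolding newton_op_def u_def using assms(5) by (simp add: ennpowr_SUP SUP_mult_left_ennreal)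
      also have "\<dots> = (SUP n. \<integral>\<^sup>+y. newton_kernel (x - y) * ennreal (\<alpha> y) * ennpowr (U n y) p \<partial>lborel)"
        using U_inc assms(5)
        by (intro nn_integral_monotone_convergence_SUP)
           (auto simp: incseq_def le_fun_def intro!: mult_left_mono ennpowr_mono)
      finally show ?thesis by (simp add: newton_op_def)
    qed
    then have "F u x = (SUP n. U (Suc n) x)"
      by (simp add: F_def U_simps(2) ennreal_SUP_add_left)
    \<comment> \<open>Dropping the first term does not change the supremum of an increasing
      sequence.\<close>
    also have "\<dots> = u x"
      unfolding u_def using U_step
      by (intro antisym SUP_mono) (auto intro: exI[of _ "Suc _"])
    finally show ?thesis by simp
  qed
  have u_v: "AE x in lborel. u x \<le> v x"
    using super by (intro below) (simp add: F_def)
  have u_pos: "0 < u x" for x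
  proof -
    obtain g0 where "g0 > 0" "ennreal g0 \<le> newton_potential \<mu> x"
      using newton_potential_pos_lower_bound[OF assms(1-3), of "norm x"] by blast
    then have "0 < ennreal \<kappa> * newton_potential \<mu> x"
      using assms(6) less_le_trans[of 0 "ennreal g0"] by (simp add: ennreal_zero_less_mult_iff)
    also have "\<dots> \<le> F u x" unfolding F_def by simp
    finally show ?thesis by (subst u_fix)
  qed
  have "is_solution \<alpha> p \<mu> \<kappa> u"
    unfolding is_solution_iff
  proof (intro conjI)
    show "u \<in> borel_measurable lebesgue" using u_meas by (intro measurable_completion) simp
    show "AE x in lborel. 0 < u x \<and> u x < \<infinity>"
      using u_v fin by eventually_elim (use u_pos in auto)
    show "AE x in lborel. u x = newton_op \<alpha> p u x + ennreal \<kappa> * newton_potential \<mu> x"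
      using u_fix by (simp add: F_def)
  qed
  moreover have "AE x in lborel. u x \<le> w x" if "is_solution \<alpha> p \<mu> \<kappa> w" for w
  proof (rule below)
    have "AE x in lborel. w x = F w x"
      using that by (simp add: is_solution_iff F_def)
    then show "AE x in lborel. F w x \<le> w x" by eventually_elim simp
  qed
  ultimately show ?thesis
    using that u_v by (auto simp: is_minimal_solution_def AE_completion_iff)
qed

text \<open>On an annulus \<open>A\<close> the kernel, the coefficient and the potential all have
  positive lower bounds, so \<open>u \<ge> C * I + \<kappa> * g0\<close> there. Taking the power
  \<open>p\<close> and integrating over \<open>A\<close> feeds this back into \<open>I\<close>;
  since \<open>p > 1\<close>, the result is impossible for large \<kappa>.\<close>

lemma solution_scale_bound:
  fixes \<mu> :: "'a::euclidean_space measure"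
  assumes "DIM('a) \<ge> 3" "radon_measure \<mu>" "emeasure \<mu> (space \<mu>) \<noteq> 0"
    and cont: "continuous_on (- {0}) \<alpha>" and pos: "\<And>x. x \<noteq> 0 \<Longrightarrow> \<alpha> x > 0" and "1 < p"
  obtains K :: real where "\<And>\<kappa> u. 0 < \<kappa> \<Longrightarrow> is_solution \<alpha> p \<mu> \<kappa> u \<Longrightarrow> \<kappa> \<le> K"
proof -
  have \<alpha>_meas [measurable]: "\<alpha> \<in> borel_measurable borel"
    using cont by (intro borel_measurable_continuous_countable_exceptions[of "{0}"]) auto
  \<comment> \<open>A compact set away from the origin, so that \<alpha> attains a positive minimum
    on it.\<close>
  define A :: "'a set" where "A = cball 0 2 - ball 0 1"
  have A_meas [measurable]: "A \<in> sets borel" by (simp add: A_def)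
  have A_compact: "compact A" unfolding A_def by (intro compact_diff) auto
  \<comment> \<open>Two points of \<open>A\<close> are at distance at most 4, so
    \<open>newton_kernel e\<close> bounds the kernel below on \<open>A\<close>. The ball around
    \<open>e1\<close> shows that \<open>A\<close> has positive measure.\<close>
  obtain e :: 'a where e: "norm e = 4" using vector_choose_size[of 4] by auto
  obtain e1 :: 'a where e1: "norm e1 = 3/2" using vector_choose_size[of "3/2"] by auto
  have ball_A: "ball e1 (1/2) \<subseteq> A"
  proof
    fix x assume "x \<in> ball e1 (1/2)"
    then have "norm (x - e1) < 1/2" by (simp add: dist_norm norm_minus_commute)
    then show "x \<in> A" 
      using norm_triangle_ineq2[of x e1] norm_triangle_ineq2[of e1 x] e1
      by (auto simp: A_def norm_minus_commute)
  qed
  have "emeasure lborel (ball e1 (1/2)) \<le> emeasure lborel A"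
    using ball_A by (intro emeasure_mono) auto
  moreover have "0 < emeasure lborel (ball e1 (1/2))" by (simp add: emeasure_ball unit_ball_vol_pos)
  moreover have "emeasure lborel A < \<infinity>"
    using A_compact emeasure_bounded_finite[OF compact_imp_bounded] by auto
  ultimately have A_pos: "0 < emeasure lborel A" "emeasure lborel A < \<infinity>"
    by (blast intro: less_le_trans)+
  then obtain mA where mA: "mA > 0" "emeasure lborel A = ennreal mA"
    by (cases "emeasure lborel A") auto
  obtain g0 where g0: "g0 > 0" "\<And>x. x \<in> A \<Longrightarrow> ennreal g0 \<le> newton_potential \<mu> x"
  proof -
    obtain g0 where "g0 > 0" "\<And>x. norm x \<le> 2 \<Longrightarrow> ennreal g0 \<le> newton_potential \<mu> x"
      using newton_potential_pos_lower_bound[OF assms(1-3)] by blast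
    then show ?thesis by (intro that[of g0]) (auto simp: A_def)
  qed
  have "0 \<notin> A" by (simp add: A_def)
  have "A \<noteq> {}" using ball_A by auto
  then obtain z where z: "z \<in> A" "\<And>x. x \<in> A \<Longrightarrow> \<alpha> z \<le> \<alpha> x"
    using continuous_attains_inf[OF A_compact, of \<alpha>] continuous_on_subset[OF cont, of A] \<open>0 \<notin> A\<close> by auto
  obtain k0 where k0: "k0 > 0" "newton_kernel e = ennreal k0"
  proof -
    have "e \<noteq> 0" using e by auto
    moreover obtain C where "C > 0" "\<And>x::'a. x \<noteq> 0 \<Longrightarrow> newton_kernel x = ennreal (C * norm x powr (2 - real DIM('a)))"
      using newton_kernel_formula[OF assms(1)] by metis
    ultimately show ?thesis by (intro that[of "C * norm e powr (2 - real DIM('a))"]) simp_all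
  qed
  define C where "C = k0 * \<alpha> z"
  have "z \<noteq> 0" using z(1) \<open>0 \<notin> A\<close> by metis
  then have \<alpha>z: "\<alpha> z > 0" by (rule pos)
  have C: "C > 0" unfolding C_def using k0(1) \<alpha>z by (rule mult_pos_pos)
  have bound: "mA * C * (\<kappa> * g0) powr (p - 1) < 1" if \<kappa>: "0 < \<kappa>" and sol: "is_solution \<alpha> p \<mu> \<kappa> u" for \<kappa> u
  proof -
    define I where "I = (\<integral>\<^sup>+y. ennpowr (u y) p * indicator A y \<partial>lborel)"
    have u_lower: "AE x in lborel. x \<in> A \<longrightarrow> ennreal C * I + ennreal (\<kappa> * g0) \<le> u x"
    proof -
      have "ennreal C * I \<le> newton_op \<alpha> p u x" if "x \<in> A" for x
      proof -
        have *: "ennreal C * (ennpowr (u y) p * indicator A y) \<le> newton_kernel (x - y) * ennreal (\<alpha> y) * ennpowr (u y) p" for y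
        proof (cases "y \<in> A")
          case True
          have "norm (x - y) \<le> norm e"
            using norm_triangle_ineq4[of x y] \<open>x \<in> A\<close> True e by (auto simp: A_def)
          then have "ennreal k0 \<le> newton_kernel (x - y)"
            unfolding k0(2)[symmetric] by (intro newton_kernel_antimono assms)
          then have "ennreal C \<le> newton_kernel (x - y) * ennreal (\<alpha> y)"
            unfolding C_def using k0(1) z(2)[OF True] \<alpha>z
            by (simp add: ennreal_mult' mult_mono ennreal_leI)
          then show ?thesis using True by (simp add: mult_right_mono)
        qed simp
        have "ennreal C * I \<le> (\<integral>\<^sup>+y. ennreal C * (ennpowr (u y) p * indicator A y) \<partial>lborel)"
        proof -
          \<comment> \<open>A solution is only Lebesgue measurable, so the constant is pulled out of
            the integral over \<open>lebesgue\<close> and the result is transferred to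
            \<open>lborel\<close>.\<close>
          have [measurable]: "u \<in> borel_measurable lebesgue" using sol by (simp add: is_solution_def)
          have [measurable]: "A \<in> sets lebesgue" by simp
          have "ennreal C * (\<integral>\<^sup>+y. ennpowr (u y) p * indicator A y \<partial>lebesgue) =
            (\<integral>\<^sup>+y. ennreal C * (ennpowr (u y) p * indicator A y) \<partial>lebesgue)"
            by (rule nn_integral_cmult[symmetric]) measurable
          then show ?thesis by (simp add: I_def nn_integral_completion)
        qed
        also have "\<dots> \<le> newton_op \<alpha> p u x"
          unfolding newton_op_def by (intro nn_integral_mono *)
        finally show ?thesis .
      qed
      moreover have "ennreal (\<kappa> * g0) \<le> ennreal \<kappa> * newton_potential \<mu> x" if "x \<in> A" for x
        using g0(1) g0(2)[OF that] \<kappa> by (simp add: ennreal_mult mult_left_mono)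
      moreover have "AE x in lborel. u x = newton_op \<alpha> p u x + ennreal \<kappa> * newton_potential \<mu> x"
        using sol by (simp add: is_solution_iff)
      ultimately show ?thesis
        by (auto elim!: eventually_mono intro!: add_mono)
    qed
    \<comment> \<open>If \<open>I\<close> were infinite, the lower bound would force
      \<open>u\<close> to be infinite a.e. on \<open>A\<close>, a set of positive measure.\<close>
    have "I < top"
    proof (rule ccontr)
      assume "\<not> I < top"
      then have "I = top" by (metis top.not_eq_extremum)
      have "AE x in lborel. 0 < u x \<and> u x < \<infinity>"
        using sol by (simp add: is_solution_iff)
      with u_lower have "AE x in lborel. x \<notin> A"
      proof eventually_elim
        case (elim x)
        with C show ?case by (auto simp: \<open>I = top\<close> ennreal_mult_top top_unique)
      qed
      then have "emeasure lborel A = 0" by (subst (asm) AE_iff_measurable[OF _ refl]) auto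
      then show False using mA by auto
    qed
    then obtain i where i: "I = ennreal i" "i \<ge> 0" by (cases I) auto
    from u_lower have "AE x in lborel. ennreal ((C * i + \<kappa> * g0) powr p) * indicator A x \<le> ennpowr (u x) p * indicator A x"
    proof eventually_elim
      case (elim x)
      have "0 \<le> C * i + \<kappa> * g0" using i C \<kappa> g0 by auto
      moreover have "ennreal (C * i + \<kappa> * g0) \<le> u x" if "x \<in> A"
        using elim that i C \<kappa> g0 by (simp add: ennreal_mult ennreal_plus)
      ultimately show ?case
        using ennpowr_mono[of p "ennreal (C * i + \<kappa> * g0)" "u x"] \<open>1 < p\<close>
        by (auto simp: indicator_def ennpowr_ennreal)
    qed
    then have "(\<integral>\<^sup>+x. ennreal ((C * i + \<kappa> * g0) powr p) * indicator A x \<partial>lborel) \<le> I"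
      unfolding I_def by (rule nn_integral_mono_AE)
    then have "(C * i + \<kappa> * g0) powr p * mA \<le> i"
      using mA i by (simp add: nn_integral_cmult_indicator flip: ennreal_mult)
    moreover define s where "s = C * i + \<kappa> * g0"
    ultimately have le: "s powr p * mA \<le> i" by simp
    have s_pos: "s > 0" and s_ge: "\<kappa> * g0 \<le> s" "C * i < s"
      using i C \<kappa> g0 by (auto simp: s_def add_nonneg_pos)
    then have "0 < s powr p * mA" using mA by simp
    then have i_pos: "i > 0" using le by linarith
    \<comment> \<open>One factor \<open>s\<close> is bounded below by \<open>C * i\<close>, the
      remaining power by that of \<open>\<kappa> * g0\<close>. The first bound is strict and
      \<open>i > 0\<close>, so \<open>i\<close> cancels and leaves a strict inequality.\<close>
    have "s powr p = s * s powr (p - 1)"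
      using s_pos powr_add[of s 1 "p - 1"] by simp
    moreover have "s powr (p - 1) \<ge> (\<kappa> * g0) powr (p - 1)"
      using s_ge \<kappa> g0 assms(6) by (intro powr_mono2) auto
    moreover have "(\<kappa> * g0) powr (p - 1) > 0" using \<kappa> g0 by auto
    ultimately have "C * i * (\<kappa> * g0) powr (p - 1) < s powr p"
      using s_ge s_pos i C by (auto intro!: mult_less_le_imp_less)
    then have "C * i * (\<kappa> * g0) powr (p - 1) * mA < i"
      using le mult_strict_right_mono[OF _ mA(1)] by (meson less_le_trans)
    then have "i * (mA * C * (\<kappa> * g0) powr (p - 1)) < i * 1" by (simp add: ac_simps)
    then show ?thesis using i_pos by (simp only: mult_less_cancel_left_pos)
  qed
  show ?thesis
  proof
    fix \<kappa> u assume *: "0 < \<kappa>" "is_solution \<alpha> p \<mu> \<kappa> u"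
    \<comment> \<open>The bound solves \<open>mA * C * (\<kappa> * g0) powr (p - 1) = 1\<close> for
      \<kappa>.\<close>
    show "\<kappa> \<le> (1 / (mA * C)) powr (1 / (p - 1)) / g0"
    proof (rule ccontr)
      assume "\<not> ?thesis"
      then have "(1 / (mA * C)) powr (1 / (p - 1)) \<le> \<kappa> * g0" using g0 by (simp add: field_simps)
      then have "((1 / (mA * C)) powr (1 / (p - 1))) powr (p - 1) \<le> (\<kappa> * g0) powr (p - 1)"
        using assms(6) by (intro powr_mono2) auto
      then have "1 / (mA * C) \<le> (\<kappa> * g0) powr (p - 1)"
        using assms(6) mA C by (simp add: powr_powr)
      then show False using bound[OF *] mA C by (simp add: field_simps)
    qed
  qed
qed

subsection \<open>Bounded potentials\<close>

lemma annulus_measurable [measurable]: "annulus R \<in> sets (borel :: 'a::euclidean_space measure)"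
  by (simp add: annulus_def)

section \<open>Dyadic shells and geometric sums\<close>

lemma power_powr:
  fixes x :: real
  assumes "0 \<le> x"
  shows "(x ^ n) powr s = (x powr s) ^ n"
  using assms by (induction n) (simp_all add: powr_mult)

lemma ennreal_le_suminf: "f n \<le> (\<Sum>n. f n :: ennreal)"
  using sum_le_suminf[of f "{n}"] by simp

text \<open>The least \<open>n\<close> satisfying the lower bound works: minimality gives the upper
  bound, which for \<open>n = 0\<close> is \<open>t < R\<close>. The same argument proves
  \<open>dyadic_above\<close>.\<close>

lemma dyadic_below:
  fixes t R :: real
  assumes "0 < t" "t < R"
  obtains n where "R * (1/2) ^ Suc n \<le> t" "t < R * (1/2) ^ n"
proof -
  have "\<exists>n. R * (1/2) ^ Suc n \<le> t"
  proof -
    obtain n where "(1/2::real) ^ n < t / R"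
      using real_arch_pow_inv[of "t / R" "1/2"] assms by auto
    then have "R * (1/2) ^ n < t" using assms by (simp add: field_simps)
    moreover have "R * (1/2) ^ Suc n \<le> R * (1/2) ^ n" using assms by simp
    ultimately show ?thesis by (intro exI[of _ n]) linarith
  qed
  then obtain n where n: "R * (1/2) ^ Suc n \<le> t" "\<And>m. m < n \<Longrightarrow> \<not> R * (1/2) ^ Suc m \<le> t"
    using exists_least_iff[of "\<lambda>n. R * (1/2) ^ Suc n \<le> t"] by blast
  show ?thesis
  proof (rule that[OF n(1)])
    show "t < R * (1/2) ^ n"
    proof (cases n)
      case (Suc m)
      then show ?thesis using n(2)[of m] by simp
    qed (use assms in simp)
  qed
qed

lemma dyadic_above:
  fixes t :: real
  assumes "1 \<le> t"
  obtains n where "2 ^ n \<le> t" "t < 2 ^ Suc n"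
proof -
  have "\<exists>n. t < 2 ^ Suc n"
  proof -
    obtain n where "t < (2::real) ^ n" using real_arch_pow[of 2 t] by auto
    then show ?thesis using assms by (intro exI[of _ n]) simp
  qed
  then obtain n where n: "t < 2 ^ Suc n" "\<And>m. m < n \<Longrightarrow> \<not> t < 2 ^ Suc m"
    using exists_least_iff[of "\<lambda>n. t < 2 ^ Suc n"] by blast
  show ?thesis
  proof (rule that[OF _ n(1)])
    show "2 ^ n \<le> t"
    proof (cases n)
      case (Suc m)
      then show ?thesis using n(2)[of m] by simp
    qed (use assms in simp)
  qed
qed

lemma suminf_ennreal_geometric:
  assumes "0 \<le> C" "0 \<le> q" "q < (1::real)"
  shows "(\<Sum>n. ennreal (C * q ^ n)) = ennreal (C / (1 - q))"
proof -
  have "summable (\<lambda>n. q ^ n)" using assms by (intro summable_geometric) auto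
  then have "(\<Sum>n. ennreal (C * q ^ n)) = ennreal (\<Sum>n. C * q ^ n)"
    using assms by (intro suminf_ennreal2) (auto intro: summable_mult)
  also have "(\<Sum>n. C * q ^ n) = C / (1 - q)"
    using assms suminf_geometric[of q] \<open>summable (\<lambda>n. q ^ n)\<close> by (simp add: suminf_mult)
  finally show ?thesis .
qed

text \<open>On each dyadic shell around \<open>x\<close> the integrand is at most its value at the
  inner radius. Enlarging the shells to full balls, whose volumes are explicit, leaves a geometric
  series.\<close>

lemma nn_integral_norm_powr_ball:
  assumes "0 \<le> \<tau>" "\<tau> < real DIM('a::euclidean_space)"
  obtains M where "M \<ge> 0"
    "\<And>(x::'a) R. 0 < R \<Longrightarrow> (\<integral>\<^sup>+y. ennreal (norm (x - y) powr (- \<tau>)) * indicator (ball x R) y \<partial>lborel)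
      \<le> ennreal (M * R powr (real DIM('a) - \<tau>))"
proof
  define V where "V = unit_ball_vol (real DIM('a))"
  have V: "V > 0" unfolding V_def by (simp add: unit_ball_vol_pos)
  \<comment> \<open>The ratio of consecutive shell contributions, below 1 because
    \<open>\<tau> < N\<close>.\<close>
  define q where "q = 2 powr \<tau> * (1/2) ^ DIM('a)"
  have "2 powr \<tau> < 2 powr real DIM('a)" using assms by simp
  then have "2 powr \<tau> < 2 ^ DIM('a)" by (simp add: powr_realpow)
  then have q: "0 \<le> q" "q < 1" by (auto simp: q_def field_simps)
  show "0 \<le> 2 powr \<tau> * V / (1 - q)" using q V by auto
  fix x :: 'a and R :: real assume R: "0 < R"
  have "(\<integral>\<^sup>+y. ennreal (norm (x - y) powr (- \<tau>)) * indicator (ball x R) y \<partial>lborel)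
    \<le> (\<integral>\<^sup>+y. (\<Sum>n. ennreal ((R * (1/2) ^ Suc n) powr (- \<tau>)) * indicator (ball x (R * (1/2) ^ n)) y) \<partial>lborel)"
  proof (intro nn_integral_mono)
    fix y
    let ?f = "\<lambda>n. ennreal ((R * (1/2) ^ Suc n) powr (- \<tau>)) * indicator (ball x (R * (1/2) ^ n)) y"
    show "ennreal (norm (x - y) powr (- \<tau>)) * indicator (ball x R) y \<le> (\<Sum>n. ?f n)"
    \<comment> \<open>At \<open>y = x\<close> the real power is
      \<open>0 powr (- \<tau>) = 0\<close>, so the centre belongs to the trivial case.\<close>
    proof (cases "y \<in> ball x R \<and> y \<noteq> x")
      case True
      then have *: "0 < norm (x - y)" "norm (x - y) < R" by (auto simp: dist_norm)
      obtain n where n: "R * (1/2) ^ Suc n \<le> norm (x - y)" "norm (x - y) < R * (1/2) ^ n"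
        using dyadic_below[OF *] by blast
      have "norm (x - y) powr (- \<tau>) \<le> (R * (1/2) ^ Suc n) powr (- \<tau>)"
        using n(1) R assms by (intro powr_mono2') auto
      then have "ennreal (norm (x - y) powr (- \<tau>)) * indicator (ball x R) y \<le> ?f n"
        using n(2) True by (simp add: dist_norm ennreal_leI)
      also have "\<dots> \<le> (\<Sum>n. ?f n)"
        by (rule ennreal_le_suminf)
      finally show ?thesis .
    qed auto
  qed
  also have "\<dots> = (\<Sum>n. \<integral>\<^sup>+y. ennreal ((R * (1/2) ^ Suc n) powr (- \<tau>)) * indicator (ball x (R * (1/2) ^ n)) y \<partial>lborel)"
  proof (rule nn_integral_suminf)
    show "(\<lambda>y. ennreal ((R * (1/2) ^ Suc n) powr (- \<tau>)) * indicator (ball x (R * (1/2) ^ n)) y)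
      \<in> borel_measurable lborel" for n
    proof -
      have "(indicator (ball x (R * (1/2) ^ n)) :: 'a \<Rightarrow> ennreal) \<in> borel_measurable lborel"
        by (rule borel_measurable_indicator) simp
      then show ?thesis by (intro borel_measurable_times_ennreal borel_measurable_const)
    qed
  qed
  also have "\<dots> = (\<Sum>n. ennreal ((2 powr \<tau> * V * R powr (real DIM('a) - \<tau>)) * q ^ n))"
  proof (intro suminf_cong)
    fix n
    have half: "(1/2) powr (- \<tau>) = 2 powr \<tau>"
      by (simp add: powr_minus powr_divide)
    have "(R * (1/2) ^ Suc n) powr (- \<tau>) = R powr (- \<tau>) * ((1/2) ^ Suc n) powr (- \<tau>)"
      by (rule powr_mult)
    also have "((1/2) ^ Suc n) powr (- \<tau>) = (2 powr \<tau>) ^ Suc n"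
      by (simp add: power_powr half del: power_Suc)
    finally have 1: "(R * (1/2) ^ Suc n) powr (- \<tau>) = R powr (- \<tau>) * (2 powr \<tau>) ^ Suc n" .
    have 2: "(R * (1/2) ^ n) ^ DIM('a) = R ^ DIM('a) * ((1/2) ^ DIM('a)) ^ n"
      unfolding power_mult_distrib by (simp only: mult.commute flip: power_mult)
    have 3: "R powr (real DIM('a) - \<tau>) = R powr (- \<tau>) * R ^ DIM('a)"
      using R powr_add[of R "- \<tau>" "real DIM('a)"] by (simp add: powr_realpow)
    have eq: "(R * (1/2) ^ Suc n) powr (- \<tau>) * (V * (R * (1/2) ^ n) ^ DIM('a))
      = (2 powr \<tau> * V * R powr (real DIM('a) - \<tau>)) * q ^ n"
      unfolding 1 unfolding 2 3 q_def by (simp only: power_mult_distrib power_Suc mult_ac)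
    show "(\<integral>\<^sup>+y. ennreal ((R * (1/2) ^ Suc n) powr (- \<tau>)) * indicator (ball x (R * (1/2) ^ n)) y \<partial>lborel)
      = ennreal ((2 powr \<tau> * V * R powr (real DIM('a) - \<tau>)) * q ^ n)"
      unfolding eq[symmetric] using R V
      by (simp add: nn_integral_cmult_indicator emeasure_ball del: power_Suc flip: V_def ennreal_mult)
  qed
  also have "\<dots> = ennreal (2 powr \<tau> * V / (1 - q) * R powr (real DIM('a) - \<tau>))"
    using q V by (subst suminf_ennreal_geometric) auto
  finally show "(\<integral>\<^sup>+y. ennreal (norm (x - y) powr (- \<tau>)) * indicator (ball x R) y \<partial>lborel)
    \<le> ennreal (2 powr \<tau> * V / (1 - q) * R powr (real DIM('a) - \<tau>))" .
qed

text \<open>The bound is uniform in \<open>x\<close> although the ball is centred at 0. Where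
  \<open>norm (x - y) < R\<close> the integral is that over \<open>ball x R\<close>; elsewhere the
  kernel is at most its value at distance \<open>R\<close>, and the volume of the ball
  suffices.\<close>

lemma nn_integral_newton_kernel_ennpowr_ball:
  assumes "DIM('a::euclidean_space) \<ge> 3" "0 < s" "(real DIM('a) - 2) * s < real DIM('a)"
  obtains M where "M \<ge> 0"
    "\<And>(x::'a) R. 0 < R \<Longrightarrow> (\<integral>\<^sup>+y. ennpowr (newton_kernel (x - y)) s * indicator (ball 0 R) y \<partial>lborel)
      \<le> ennreal (M * R powr (real DIM('a) - (real DIM('a) - 2) * s))"
proof -
  define \<tau> where "\<tau> = (real DIM('a) - 2) * s"
  have \<tau>: "0 \<le> \<tau>" "\<tau> < real DIM('a)" using assms by (auto simp: \<tau>_def)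
  obtain M where M: "M \<ge> 0" "\<And>(x::'a) R. 0 < R \<Longrightarrow> (\<integral>\<^sup>+y. ennreal (norm (x - y) powr (- \<tau>)) * indicator (ball x R) y \<partial>lborel)
      \<le> ennreal (M * R powr (real DIM('a) - \<tau>))"
    using nn_integral_norm_powr_ball[OF \<tau>] by blast
  obtain C where C: "C > 0" "\<And>x::'a. x \<noteq> 0 \<Longrightarrow> newton_kernel x = ennreal (C * norm x powr (2 - real DIM('a)))"
    using newton_kernel_formula[OF assms(1)] by metis
  define V where "V = unit_ball_vol (real DIM('a))"
  have V: "V > 0" unfolding V_def by (simp add: unit_ball_vol_pos)
  have ker: "ennpowr (newton_kernel x) s = ennreal (C powr s * norm x powr (- \<tau>))" if "x \<noteq> 0" for x :: 'a
  proof -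
    have "(norm x powr (2 - real DIM('a))) powr s = norm x powr (- \<tau>)"
      by (simp add: powr_powr \<tau>_def algebra_simps)
    then show ?thesis using C that by (simp add: ennpowr_ennreal powr_mult)
  qed
  show ?thesis
  proof (rule that, goal_cases)
    case 1
    show "0 \<le> C powr s * (M + V)" using M V by simp
  next
    case (2 x R)
    have [measurable]: "ball x R \<in> sets borel" "ball 0 R \<in> sets borel" by simp_all
    \<comment> \<open>The pole of the kernel is a null set; off it the power law applies.\<close>
    have "AE y in lborel. y \<noteq> x" by (rule AE_lborel_singleton)
    then have "(\<integral>\<^sup>+y. ennpowr (newton_kernel (x - y)) s * indicator (ball 0 R) y \<partial>lborel)
      \<le> (\<integral>\<^sup>+y. ennreal (C powr s) * (ennreal (norm (x - y) powr (- \<tau>)) * indicator (ball x R) y)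
            + ennreal (C powr s * R powr (- \<tau>)) * indicator (ball 0 R) y \<partial>lborel)"
    proof (intro nn_integral_mono_AE, eventually_elim)
      case (elim y)
      then have k: "ennpowr (newton_kernel (x - y)) s = ennreal (C powr s * norm (x - y) powr (- \<tau>))"
        by (intro ker) auto
      show ?case
      proof (cases "norm (x - y) < R")
        case True
        then show ?thesis unfolding k
          by (auto simp: indicator_def dist_norm ennreal_mult)
      next
        case False
        then have "norm (x - y) powr (- \<tau>) \<le> R powr (- \<tau>)"
          using 2 \<tau> by (intro powr_mono2') auto
        then have "C powr s * norm (x - y) powr (- \<tau>) \<le> C powr s * R powr (- \<tau>)"
          by (intro mult_left_mono) auto
        then show ?thesis unfolding k using False
          by (auto simp: indicator_def dist_norm intro!: ennreal_leI)
      qed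
    qed
    also have "\<dots> = ennreal (C powr s) * (\<integral>\<^sup>+y. (ennreal (norm (x - y) powr (- \<tau>)) * indicator (ball x R) y) \<partial>lborel)
            + ennreal (C powr s * R powr (- \<tau>)) * emeasure lborel (ball (0::'a) R)"
      by (simp add: nn_integral_add nn_integral_cmult nn_integral_cmult_indicator)
    also have "\<dots> \<le> ennreal (C powr s) * ennreal (M * R powr (real DIM('a) - \<tau>))
            + ennreal (C powr s * R powr (- \<tau>)) * ennreal (V * R ^ DIM('a))"
      using 2 by (intro add_mono mult_left_mono M) (auto simp: emeasure_ball V_def)
    also have "\<dots> = ennreal (C powr s * (M * R powr (real DIM('a) - \<tau>)) + C powr s * R powr (- \<tau>) * (V * R ^ DIM('a)))"
      using 2 M V by (simp add: ennreal_mult)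
    also have "C powr s * (M * R powr (real DIM('a) - \<tau>)) + C powr s * R powr (- \<tau>) * (V * R ^ DIM('a))
       = C powr s * (M + V) * R powr (real DIM('a) - \<tau>)"
      using 2 by (simp add: powr_diff powr_minus powr_realpow field_simps)
    finally show "(\<integral>\<^sup>+y. ennpowr (newton_kernel (x - y)) s * indicator (ball 0 R) y \<partial>lborel)
      \<le> ennreal (C powr s * (M + V) * R powr (real DIM('a) - (real DIM('a) - 2) * s))"
      by (simp add: \<tau>_def)
  qed
qed

text \<open>Young's inequality separates \<open>newton_kernel (x - y)\<close> from \<open>h\<close>.
  The power \<open>s = r / (r - q)\<close> of the kernel is locally integrable when
  \<open>(N - 2) * s < N\<close>, which is \<open>N * q / 2 < r\<close>. \<open>G\<close> plays the
  role of an averaged size of \<open>h\<close> on the annulus.\<close>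

lemma nn_integral_newton_kernel_annulus:
  assumes "DIM('a::euclidean_space) \<ge> 3" "0 < q" "q < r" "real DIM('a) * q / 2 < r" "0 \<le> M"
  obtains K where "K \<ge> 0"
    "\<And>(h :: 'a \<Rightarrow> ennreal) x R G. h \<in> borel_measurable borel \<Longrightarrow> 0 < R \<Longrightarrow> 0 < G \<Longrightarrow>
      (\<integral>\<^sup>+y. ennpowr (h y) r * indicator (annulus R) y \<partial>lborel) \<le> ennreal (M * R ^ DIM('a) * G powr r) \<Longrightarrow>
      (\<integral>\<^sup>+y. newton_kernel (x - y) * ennpowr (h y) q * indicator (annulus R) y \<partial>lborel)
        \<le> ennreal (K * R\<^sup>2 * G powr q)"
proof -
  define N where "N = real DIM('a)"
  define s where "s = r / (r - q)"
  have s: "0 < s" using assms by (simp add: s_def)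
  have "(real DIM('a) - 2) * s < real DIM('a)"
    using assms by (simp add: s_def field_simps)
  then obtain M' where M': "M' \<ge> 0"
    "\<And>(x::'a) R. 0 < R \<Longrightarrow> (\<integral>\<^sup>+y. ennpowr (newton_kernel (x - y)) s * indicator (ball 0 R) y \<partial>lborel)
      \<le> ennreal (M' * R powr (N - (N - 2) * s))"
    using nn_integral_newton_kernel_ennpowr_ball[OF assms(1) s] unfolding N_def by blast
  show ?thesis
  proof (rule that, goal_cases)
    case 1
    show "0 \<le> M' + M" using M' assms by simp
  next
    case (2 h x R G)
    note [measurable] = 2(1)
    have [measurable]: "ball (0::'a) R \<in> sets borel" by simp
    \<comment> \<open>With this scale both terms are multiples of
      \<open>R\<^sup>2 * G powr q\<close>.\<close>
    define L where "L = R powr (N - 2)"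
    have L: "L > 0" using 2 by (simp add: L_def)
    define A where "A = G powr q * L powr (q / (r - q))"
    define B where "B = G powr (q - r) / L"
    have AB: "A \<ge> 0" "B \<ge> 0" using L by (auto simp: A_def B_def)
    have "(\<integral>\<^sup>+y. newton_kernel (x - y) * ennpowr (h y) q * indicator (annulus R) y \<partial>lborel)
      \<le> (\<integral>\<^sup>+y. ennreal A * (ennpowr (newton_kernel (x - y)) s * indicator (ball 0 R) y)
          + ennreal B * (ennpowr (h y) r * indicator (annulus R) y) \<partial>lborel)"
      using ennreal_times_ennpowr_le[OF assms(2,3) L 2(3), folded A_def B_def s_def]
      by (intro nn_integral_mono) (auto simp: indicator_def annulus_def)
    also have "\<dots> = ennreal A * (\<integral>\<^sup>+y. (ennpowr (newton_kernel (x - y)) s * indicator (ball 0 R) y) \<partial>lborel)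
          + ennreal B * (\<integral>\<^sup>+y. (ennpowr (h y) r * indicator (annulus R) y) \<partial>lborel)"
      by (simp add: nn_integral_add nn_integral_cmult)
    also have "\<dots> \<le> ennreal A * ennreal (M' * R powr (N - (N - 2) * s))
         + ennreal B * ennreal (M * R ^ DIM('a) * G powr r)"
      using 2 by (intro add_mono mult_left_mono M') auto
    also have "\<dots> = ennreal (A * (M' * R powr (N - (N - 2) * s)) + B * (M * R ^ DIM('a) * G powr r))"
      using 2 M' AB assms by (simp add: ennreal_mult)
    also have "A * (M' * R powr (N - (N - 2) * s)) = M' * R\<^sup>2 * G powr q"
    proof -
      have "(N - 2) * (q / (r - q)) + (N - (N - 2) * s) = 2"
      proof -
        have "s = 1 + q / (r - q)" using assms by (simp add: s_def field_simps)
        then show ?thesis by (simp add: algebra_simps)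
      qed
      then have "R powr ((N - 2) * (q / (r - q))) * R powr (N - (N - 2) * s) = R\<^sup>2"
        using 2 by (simp flip: powr_add)
      then show ?thesis by (simp add: A_def L_def powr_powr)
    qed
    also have "B * (M * R ^ DIM('a) * G powr r) = M * R\<^sup>2 * G powr q"
    proof -
      have "R ^ DIM('a) = R\<^sup>2 * L"
        using 2 powr_add[of R 2 "N - 2"] by (simp add: L_def N_def powr_realpow)
      then show ?thesis using 2 L by (simp add: B_def powr_diff field_simps)
    qed
    finally show "(\<integral>\<^sup>+y. newton_kernel (x - y) * ennpowr (h y) q * indicator (annulus R) y \<partial>lborel)
        \<le> ennreal ((M' + M) * R\<^sup>2 * G powr q)"
      by (simp add: algebra_simps)
  qed
qed

lemma norm_powr_annulus_le:
  assumes "x \<in> annulus R" "0 < R"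
  shows "norm x powr s \<le> 2 powr \<bar>s\<bar> * R powr s"
proof -
  have x: "R / 2 \<le> norm x" "norm x < R" using assms by (auto simp: annulus_def)
  show ?thesis
  proof (cases "0 \<le> s")
    case True
    have "norm x powr s \<le> R powr s" using x True by (intro powr_mono2) auto
    also have "\<dots> \<le> 2 powr \<bar>s\<bar> * R powr s" using ge_one_powr_ge_zero[of 2 "\<bar>s\<bar>"] by (simp add: mult_le_cancel_right1)
    finally show ?thesis .
  next
    case False
    have "norm x powr s \<le> (R / 2) powr s" using x False assms by (intro powr_mono2') auto
    also have "\<dots> = 2 powr \<bar>s\<bar> * R powr s" using False assms by (simp add: powr_divide powr_minus field_simps)
    finally show ?thesis .
  qed
qed

text \<open>Up to a constant, the annulus of radius \<open>R\<close> contributes at most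
  \<open>R powr (a + 2 + c * q)\<close> for \<open>R \<le> 1\<close> and
  \<open>R powr (b + 2 + d * q)\<close> for \<open>R > 1\<close>. The sign conditions make these
  summable over dyadic radii tending to 0 and to infinity, uniformly in \<open>x\<close>.\<close>

lemma newton_potential_weighted_bounded:
  fixes \<alpha> :: "'a::euclidean_space \<Rightarrow> real" and g :: "'a \<Rightarrow> ennreal"
  assumes "DIM('a) \<ge> 3" "0 < q" "q < r" "real DIM('a) * q / 2 < r" "0 \<le> M" "0 < C"
    and [measurable]: "\<alpha> \<in> borel_measurable borel" "g \<in> borel_measurable borel"
    and inner: "\<And>x. x \<noteq> 0 \<Longrightarrow> norm x \<le> 1 \<Longrightarrow> \<alpha> x \<le> C * norm x powr a"
    and outer: "\<And>x. norm x \<ge> 1 \<Longrightarrow> \<alpha> x \<le> C * norm x powr b"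
    and g: "\<And>R. 0 < R \<Longrightarrow> (\<integral>\<^sup>+y. ennpowr (g y) r * indicator (annulus R) y \<partial>lborel)
        \<le> ennreal (M * R ^ DIM('a) * weight c d R powr r)"
    and "0 < a + 2 + c * q" "b + 2 + d * q < 0"
  obtains B where "B \<ge> 0"
    "\<And>x. (\<integral>\<^sup>+y. newton_kernel (x - y) * ennreal (\<alpha> y) * ennpowr (g y) q \<partial>lborel) \<le> ennreal B"
proof -
  obtain K where K: "K \<ge> 0"
    "\<And>(h :: 'a \<Rightarrow> ennreal) x R G. h \<in> borel_measurable borel \<Longrightarrow> 0 < R \<Longrightarrow> 0 < G \<Longrightarrow>
      (\<integral>\<^sup>+y. ennpowr (h y) r * indicator (annulus R) y \<partial>lborel) \<le> ennreal (M * R ^ DIM('a) * G powr r) \<Longrightarrow>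
      (\<integral>\<^sup>+y. newton_kernel (x - y) * ennpowr (h y) q * indicator (annulus R) y \<partial>lborel)
        \<le> ennreal (K * R\<^sup>2 * G powr q)"
    using nn_integral_newton_kernel_annulus[OF assms(1-5)] by blast
  define J where "J = (\<lambda>x R. \<integral>\<^sup>+y. newton_kernel (x - y) * ennpowr (g y) q * indicator (annulus R) y \<partial>lborel)"
  have J: "J x R \<le> ennreal (K * R\<^sup>2 * weight c d R powr q)" if "0 < R" for x R
    unfolding J_def using that g[OF that] by (intro K assms) (auto simp: weight_def)
  \<comment> \<open>On an annulus \<open>norm y powr s\<close> and \<open>R powr s\<close> agree up
    to \<open>2 powr \<bar>s\<bar>\<close>; \<open>D\<close> covers both \<open>s = a\<close> and
    \<open>s = b\<close>.\<close>
  define D where "D = C * 2 powr (\<bar>a\<bar> + \<bar>b\<bar>)"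
  have D: "D > 0" using assms by (simp add: D_def)
  have C_le: "C * 2 powr \<bar>a\<bar> \<le> D" "C * 2 powr \<bar>b\<bar> \<le> D"
    using assms by (auto simp: D_def)
  define w where "w = (\<lambda>s R. ennreal (D * R powr s))"
  define f where "f = (\<lambda>x y s R. w s R * (newton_kernel (x - y) * ennpowr (g y) q * indicator (annulus R) y))"
  have f_meas [measurable]: "(\<lambda>y. f x y s R) \<in> borel_measurable borel" for x s R
    unfolding f_def by measurable
  have int_f: "(\<integral>\<^sup>+y. f x y s R \<partial>lborel) = w s R * J x R" for x s R
    unfolding f_def J_def by (rule nn_integral_cmult) measurable
  \<comment> \<open>The ratios of the geometric series over the inner and the outer annuli.\<close>
  define \<rho>1 where "\<rho>1 = (1/2::real) powr (a + 2 + c * q)"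
  define \<rho>2 where "\<rho>2 = (2::real) powr (b + 2 + d * q)"
  have \<rho>: "0 \<le> \<rho>1" "\<rho>1 < 1" "0 \<le> \<rho>2" "\<rho>2 < 1"
  proof -
    have "2 powr (b + 2 + d * q) < 2 powr (0::real)" using assms by (intro powr_less_mono) auto
    then show "\<rho>2 < 1" by (simp add: \<rho>2_def)
    have "(1/2) powr (a + 2 + c * q) < (1/2) powr (0::real)" using assms by (intro powr_less_mono') auto
    then show "\<rho>1 < 1" by (simp add: \<rho>1_def)
  qed (auto simp: \<rho>1_def \<rho>2_def)
  have J1: "w a ((1/2) ^ n) * J x ((1/2) ^ n) \<le> ennreal (D * K * \<rho>1 ^ n)" for x n
  proof -
    define R :: real where "R = (1/2) ^ n"
    have R: "0 < R" "R \<le> 1" by (auto simp: R_def power_le_one)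
    have "w a R * J x R \<le> ennreal (D * R powr a) * ennreal (K * R\<^sup>2 * weight c d R powr q)"
      unfolding w_def by (intro mult_left_mono J R) auto
    also have "\<dots> = ennreal (D * R powr a * (K * R\<^sup>2 * (R powr c) powr q))"
      using D K R by (simp add: ennreal_mult' weight_def)
    also have "D * R powr a * (K * R\<^sup>2 * (R powr c) powr q) = D * K * R powr (a + 2 + c * q)"
      using R by (simp add: powr_add powr_powr)
    finally show ?thesis by (simp add: R_def \<rho>1_def power_powr)
  qed
  \<comment> \<open>The annulus of radius 2 is the first to cover norms from 1 on, hence
    \<open>Suc n\<close> and the extra factor \<rho>2. All these radii exceed 1, where the weight
    has exponent \<open>d\<close>.\<close>
  have J2: "w b (2 ^ Suc n) * J x (2 ^ Suc n) \<le> ennreal (D * K * \<rho>2 * \<rho>2 ^ n)" for x n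
  proof -
    define R :: real where "R = 2 ^ Suc n"
    have "(1::real) \<le> 2 ^ n" by simp
    then have R: "1 < R" unfolding R_def power_Suc by linarith
    have "w b R * J x R \<le> ennreal (D * R powr b) * ennreal (K * R\<^sup>2 * weight c d R powr q)"
      unfolding w_def using R by (intro mult_left_mono J) auto
    also have "\<dots> = ennreal (D * R powr b * (K * R\<^sup>2 * (R powr d) powr q))"
      using D K R by (simp add: ennreal_mult' weight_def)
    also have "D * R powr b * (K * R\<^sup>2 * (R powr d) powr q) = D * K * R powr (b + 2 + d * q)"
      using R by (simp add: powr_add powr_powr)
    also have "\<dots> = D * K * \<rho>2 * \<rho>2 ^ n"
      unfolding R_def \<rho>2_def by (subst power_powr) simp_all
    finally show ?thesis by (simp add: R_def)
  qed
  \<comment> \<open>Each \<open>y \<noteq> 0\<close> lies in one annulus of the two families, and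
    the corresponding single term already dominates the integrand.\<close>
  have pt: "newton_kernel (x - y) * ennreal (\<alpha> y) * ennpowr (g y) q
      \<le> (\<Sum>n. f x y a ((1/2) ^ n)) + (\<Sum>n. f x y b (2 ^ Suc n))" if "y \<noteq> 0" for x y
  proof -
    have *: "newton_kernel (x - y) * ennreal (\<alpha> y) * ennpowr (g y) q \<le> f x y s R"
      if "y \<in> annulus R" "0 < R" "\<alpha> y \<le> C * norm y powr s" "C * 2 powr \<bar>s\<bar> \<le> D" for s R
    proof -
      have "\<alpha> y \<le> C * (2 powr \<bar>s\<bar> * R powr s)"
        using assms(6)
        by (intro order_trans[OF that(3)] mult_left_mono norm_powr_annulus_le[OF that(1,2)]) simp
      also have "\<dots> \<le> D * R powr s"
        using mult_right_mono[OF that(4), of "R powr s"] by (simp add: mult.assoc)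
      finally have "ennreal (\<alpha> y) \<le> w s R" unfolding w_def by (rule ennreal_leI)
      then have "ennreal (\<alpha> y) * (newton_kernel (x - y) * ennpowr (g y) q)
         \<le> w s R * (newton_kernel (x - y) * ennpowr (g y) q)"
        by (rule mult_right_mono) simp
      then show ?thesis using that by (simp add: f_def ac_simps)
    qed
    show ?thesis
    proof (cases "norm y < 1")
      case True
      obtain n where n: "(1/2) ^ Suc n \<le> norm y" "norm y < (1/2) ^ n"
        using dyadic_below[of "norm y" 1] True \<open>y \<noteq> 0\<close> by auto
      have "newton_kernel (x - y) * ennreal (\<alpha> y) * ennpowr (g y) q \<le> f x y a ((1/2) ^ n)"
        using n True \<open>y \<noteq> 0\<close> by (intro * inner C_le) (auto simp: annulus_def)
      also have "\<dots> \<le> (\<Sum>n. f x y a ((1/2) ^ n))"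
        by (rule ennreal_le_suminf)
      finally show ?thesis by (rule order_trans) simp
    next
      case False
      obtain n where n: "2 ^ n \<le> norm y" "norm y < 2 ^ Suc n"
        using dyadic_above[of "norm y"] False by auto
      have "newton_kernel (x - y) * ennreal (\<alpha> y) * ennpowr (g y) q \<le> f x y b (2 ^ Suc n)"
        using n False by (intro * outer C_le) (auto simp: annulus_def)
      also have "\<dots> \<le> (\<Sum>n. f x y b (2 ^ Suc n))"
        by (rule ennreal_le_suminf)
      finally show ?thesis by (rule order_trans) simp
    qed
  qed
  show ?thesis
  proof (rule that, goal_cases)
    case 1
    show "0 \<le> D * K / (1 - \<rho>1) + D * K * \<rho>2 / (1 - \<rho>2)" using D K \<rho> by simp
  next
    case (2 x)
    have "AE y in lborel. y \<noteq> (0::'a)" by (rule AE_lborel_singleton)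
    then have "(\<integral>\<^sup>+y. newton_kernel (x - y) * ennreal (\<alpha> y) * ennpowr (g y) q \<partial>lborel)
      \<le> (\<integral>\<^sup>+y. (\<Sum>n. f x y a ((1/2) ^ n)) + (\<Sum>n. f x y b (2 ^ Suc n)) \<partial>lborel)"
      by (intro nn_integral_mono_AE, eventually_elim) (rule pt)
    also have "\<dots> = (\<Sum>n. w a ((1/2) ^ n) * J x ((1/2) ^ n)) + (\<Sum>n. w b (2 ^ Suc n) * J x (2 ^ Suc n))"
      by (simp add: nn_integral_add nn_integral_suminf int_f del: power_Suc)
    also have "\<dots> \<le> (\<Sum>n. ennreal (D * K * \<rho>1 ^ n)) + (\<Sum>n. ennreal (D * K * \<rho>2 * \<rho>2 ^ n))"
      by (intro add_mono suminf_le J1 J2) auto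
    also have "\<dots> = ennreal (D * K / (1 - \<rho>1) + D * K * \<rho>2 / (1 - \<rho>2))"
    proof -
      have nn: "0 \<le> D * K" "0 \<le> D * K * \<rho>2" using D K \<rho> by simp_all
      show ?thesis
        unfolding suminf_ennreal_geometric[OF nn(1) \<rho>(1,2)] suminf_ennreal_geometric[OF nn(2) \<rho>(3,4)]
        using nn \<rho> by (subst ennreal_plus) auto
    qed
    finally show "(\<integral>\<^sup>+y. newton_kernel (x - y) * ennreal (\<alpha> y) * ennpowr (g y) q \<partial>lborel)
      \<le> ennreal (D * K / (1 - \<rho>1) + D * K * \<rho>2 / (1 - \<rho>2))" .
  qed
qed

subsection \<open>Weighted spaces\<close>

lemma e2ennreal_abs_enn2ereal [simp]: "e2ennreal \<bar>enn2ereal x\<bar> = x"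
  by (simp add: enn2ereal_nonneg)

lemma ennreal_divide_antimono:
  fixes x y :: ennreal
  assumes "0 < v" "v \<le> w" "x \<le> y"
  shows "x / ennreal w \<le> y / ennreal v"
proof -
  have "x * ennreal (inverse w) \<le> y * ennreal (inverse v)"
    using assms by (intro mult_mono ennreal_leI le_imp_inverse_le) auto
  then show ?thesis
    using assms by (simp add: divide_ennreal_def inverse_ennreal)
qed

text \<open>Extracts the \<open>L^q\<close> norm on one annulus from a bound on the weighted
  supremum; \<open>L\<close> is not known in advance to be finite.\<close>

lemma ennreal_le_of_scaled_le:
  assumes "0 < A" "0 < w" "0 \<le> W" "ennreal A * (L / ennreal w) \<le> ennreal W"
  shows "L \<le> ennreal (W * w / A)"
proof (cases L)
  case (real l)
  then have "A * (l / w) \<le> W" using assms by (simp add: divide_ennreal flip: ennreal_mult)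
  then have "l \<le> W * w / A" using assms by (simp add: field_simps)
  then show ?thesis using real by (simp add: ennreal_leI)
next
  case top
  then show ?thesis using assms by (simp add: ennreal_top_divide ennreal_mult_top top_unique)
qed

lemma AE_lebesgue_on_iff:
  assumes "S \<in> sets lebesgue"
  shows "(AE x in lebesgue_on S. P x) \<longleftrightarrow> (AE x in lborel. x \<in> S \<longrightarrow> P x)"
  using assms by (simp add: AE_restrict_space_iff AE_completion_iff)

lemma Lq_norm_mono_AE:
  fixes f g :: "'a::euclidean_space \<Rightarrow> ennreal"
  assumes "f \<in> borel_measurable lebesgue" "AE x in lborel. f x \<le> g x" "0 < q" "S \<in> sets lebesgue"
  shows "Lq_norm q S (\<lambda>x. enn2ereal (f x)) \<le> Lq_norm q S (\<lambda>x. enn2ereal (g x))"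
proof -
  have le: "AE x in lebesgue_on S. f x \<le> g x"
    unfolding AE_lebesgue_on_iff[OF assms(4)] using assms(2) by eventually_elim simp
  have q: "0 < real_of_ereal q" if "q \<noteq> \<infinity>" using assms(3) that by (cases q) auto
  show ?thesis
  proof (cases "q = \<infinity>")
    case True
    \<comment> \<open>Measurability matters here because \<open>esssup\<close> is \<open>top\<close>
      on nonmeasurable functions.\<close>
    have "f \<in> borel_measurable (lebesgue_on S)"
      using assms(1) by (rule measurable_restrict_space1)
    then show ?thesis using True le by (simp add: Lq_norm_def esssup_AE_mono)
  next
    case False
    have "AE x in lebesgue_on S. ennpowr (f x) (real_of_ereal q) \<le> ennpowr (g x) (real_of_ereal q)"
      using le q[OF False] by (auto elim!: eventually_mono intro!: ennpowr_mono)
    then show ?thesis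
      using False q[OF False] by (auto simp: Lq_norm_def intro!: ennpowr_mono nn_integral_mono_AE)
  qed
qed

text \<open>A smaller exponent on radii up to 1 and a larger one beyond 1 both enlarge the weight,
  which is divided by; a smaller function decreases the numerator.\<close>

lemma weighted_Lq_mono:
  fixes f g :: "'a::euclidean_space \<Rightarrow> ennreal"
  assumes f: "f \<in> borel_measurable lebesgue" "AE x in lborel. f x \<le> g x" and "0 < q"
    and "c' \<le> c" "d \<le> d'"
    and g: "(\<lambda>x. enn2ereal (g x)) \<in> weighted_Lq q c d"
  shows "(\<lambda>x. enn2ereal (f x)) \<in> weighted_Lq q c' d'"
proof -
  have meas: "(\<lambda>x. enn2ereal (f x)) \<in> borel_measurable (lebesgue_on (- {0}))"
    using f(1) by (intro measurable_restrict_space1) measurable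
  have "Lq_norm q K (\<lambda>x. enn2ereal (f x)) < \<infinity>" if "compact K" "K \<subseteq> - {0}" for K
  proof -
    have "K \<in> sets lebesgue" using that(1) by (simp add: compact_imp_closed borel_closed)
    then have "Lq_norm q K (\<lambda>x. enn2ereal (f x)) \<le> Lq_norm q K (\<lambda>x. enn2ereal (g x))"
      by (intro Lq_norm_mono_AE f assms(3))
    also have "\<dots> < \<infinity>"
      using g that by (simp add: weighted_Lq_def Lq_loc_punctured_def)
    finally show ?thesis .
  qed
  moreover have "weighted_norm q c' d' (\<lambda>x. enn2ereal (f x)) < \<infinity>"
  proof -
    have "weighted_norm q c' d' (\<lambda>x. enn2ereal (f x)) \<le> weighted_norm q c d (\<lambda>x. enn2ereal (g x))"
      unfolding weighted_norm_def
    proof (rule SUP_subset_mono[OF order_refl])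
      fix R :: real
      have an: "annulus R \<in> sets (lebesgue :: 'a measure)" using annulus_measurable[of R] by simp
      show "ennreal (R powr (- real_of_ereal (ereal (real DIM('a)) / q)))
       * (Lq_norm q (annulus R) (\<lambda>x::'a. enn2ereal (f x)) / ennreal (weight c' d' R))
       \<le> ennreal (R powr (- real_of_ereal (ereal (real DIM('a)) / q)))
       * (Lq_norm q (annulus R) (\<lambda>x::'a. enn2ereal (g x)) / ennreal (weight c d R))"
        if "R \<in> {0<..}"
      proof -
        have "0 < weight c d R" "weight c d R \<le> weight c' d' R"
          using that assms(4,5) by (auto simp: weight_def intro: powr_mono' powr_mono)
        then show ?thesis
          by (intro mult_left_mono ennreal_divide_antimono Lq_norm_mono_AE f assms(3) an) auto
      qed
    qed
    also have "\<dots> < \<infinity>" using g by (simp add: weighted_Lq_def)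
    finally show ?thesis .
  qed
  ultimately show ?thesis
    using meas by (simp add: weighted_Lq_def Lq_loc_punctured_def)
qed

text \<open>The case \<open>q = \<infinity>\<close> is reduced to a finite exponent, chosen above a prescribed bound.\<close>

lemma weighted_Lq_annulus_bound:
  fixes g :: "'a::euclidean_space \<Rightarrow> ennreal"
  assumes g: "(\<lambda>x. enn2ereal (g x)) \<in> weighted_Lq q c d" and "ereal B < q" "0 \<le> B"
  obtains r M where "B < r" "0 \<le> M"
    "\<And>R. 0 < R \<Longrightarrow> (\<integral>\<^sup>+y. ennpowr (g y) r * indicator (annulus R) y \<partial>lborel)
        \<le> ennreal (M * R ^ DIM('a) * weight c d R powr r)"
proof -
  define W where "W = enn2real (weighted_norm q c d (\<lambda>x. enn2ereal (g x)))"
  have W: "0 \<le> W" "weighted_norm q c d (\<lambda>x. enn2ereal (g x)) = ennreal W"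
    using g by (auto simp: W_def weighted_Lq_def)
  have w_pos: "0 < weight c d R" if "0 < R" for R using that by (simp add: weight_def)
  have bound: "Lq_norm q (annulus R) (\<lambda>x. enn2ereal (g x))
      \<le> ennreal (W * weight c d R / R powr (- real_of_ereal (ereal (real DIM('a)) / q)))" if "0 < R" for R
  proof (rule ennreal_le_of_scaled_le)
    show "ennreal (R powr - real_of_ereal (ereal (real DIM('a)) / q)) *
        (Lq_norm q (annulus R) (\<lambda>x. enn2ereal (g x)) / ennreal (weight c d R)) \<le> ennreal W"
      unfolding W(2)[symmetric] weighted_norm_def using that by (intro SUP_upper) auto
  qed (use that w_pos W in auto)
  have an: "annulus R \<in> sets (lebesgue :: 'a measure)" for R using annulus_measurable[of R] by simp
  show ?thesis
  proof (cases q)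
    case (real \<rho>)
    then have \<rho>: "B < \<rho>" "0 < \<rho>" using assms by auto
    show ?thesis
    proof (rule that[of \<rho> "W powr \<rho>"])
      fix R :: real assume R: "0 < R"
      have "(\<integral>\<^sup>+y. ennpowr (g y) \<rho> * indicator (annulus R) y \<partial>lborel)
         = ennpowr (Lq_norm q (annulus R) (\<lambda>x. enn2ereal (g x))) \<rho>"
        using \<rho> an real
        by (simp add: Lq_norm_def ennpowr_ennpowr nn_integral_restrict_space nn_integral_completion)
      also have "\<dots> \<le> ennpowr (ennreal (W * weight c d R / R powr (- (real DIM('a) / \<rho>)))) \<rho>"
        using bound[OF R] \<rho> real by (intro ennpowr_mono) auto
      \<comment> \<open>Raised to the power \<rho>, the normalising factor becomes the volume scale
        \<open>R ^ N\<close>.\<close>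
      also have "\<dots> = ennreal (W powr \<rho> * R ^ DIM('a) * weight c d R powr \<rho>)"
        using R W w_pos[OF R] \<rho>
        by (simp add: ennpowr_ennreal powr_divide powr_mult powr_powr powr_minus powr_realpow field_simps)
      finally show "(\<integral>\<^sup>+y. ennpowr (g y) \<rho> * indicator (annulus R) y \<partial>lborel)
         \<le> ennreal (W powr \<rho> * R ^ DIM('a) * weight c d R powr \<rho>)" .
    qed (use \<rho> in auto)
  next
    case PInf
    define V where "V = unit_ball_vol (real DIM('a))"
    have V: "V > 0" unfolding V_def by (simp add: unit_ball_vol_pos)
    \<comment> \<open>Any finite exponent above \<open>B\<close> serves: an essential bound on the
      annulus is integrated over the enclosing ball, whose volume is
      \<open>V * R ^ N\<close>.\<close>
    define r where "r = B + 1"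
    have r: "0 < r" using assms by (simp add: r_def)
    show ?thesis
    proof (rule that[of r "W powr r * V"])
      fix R :: real assume R: "0 < R"
      have "Lq_norm q (annulus R) (\<lambda>x. enn2ereal (g x)) \<le> ennreal (W * weight c d R)"
        using bound[OF R] PInf R by simp
      then have "esssup (lebesgue_on (annulus R)) g \<le> ennreal (W * weight c d R)"
        using PInf by (simp add: Lq_norm_def)
      then have "AE x in lebesgue_on (annulus R). g x \<le> ennreal (W * weight c d R)"
        using esssup_AE[of g "lebesgue_on (annulus R)"] by (auto elim!: eventually_mono)
      then have le: "AE x in lborel. x \<in> annulus R \<longrightarrow> g x \<le> ennreal (W * weight c d R)"
        unfolding AE_lebesgue_on_iff[OF an] .
      have "(\<integral>\<^sup>+y. ennpowr (g y) r * indicator (annulus R) y \<partial>lborel)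
        \<le> (\<integral>\<^sup>+y. ennreal ((W * weight c d R) powr r) * indicator (ball (0::'a) R) y \<partial>lborel)"
      proof (rule nn_integral_mono_AE, use le in eventually_elim)
        case (elim y)
        have "ennpowr (g y) r \<le> ennreal ((W * weight c d R) powr r)" if "y \<in> annulus R"
          using ennpowr_mono[of r "g y" "ennreal (W * weight c d R)"] elim that r W w_pos[OF R]
          by (simp add: ennpowr_ennreal)
        then show ?case by (auto simp: indicator_def annulus_def)
      qed
      also have "\<dots> = ennreal (W powr r * V * R ^ DIM('a) * weight c d R powr r)"
      proof -
        have "(W * weight c d R) powr r * (V * R ^ DIM('a)) = W powr r * V * R ^ DIM('a) * weight c d R powr r"
          by (simp add: powr_mult mult_ac)
        then show ?thesis
          using R V by (simp add: nn_integral_cmult_indicator emeasure_ball flip: V_def ennreal_mult)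
      qed
      finally show "(\<integral>\<^sup>+y. ennpowr (g y) r * indicator (annulus R) y \<partial>lborel)
        \<le> ennreal (W powr r * V * R ^ DIM('a) * weight c d R powr r)" .
    qed (use V in \<open>auto simp: r_def\<close>)
  qed (use assms in auto)
qed

subsection \<open>Supersolutions for small parameters\<close>

text \<open>Compactness controls the region between the neighbourhoods of 0 and of infinity on which
  the limits superior give bounds.\<close>

lemma powr_weight_bounded_on_annulus:
  fixes \<alpha> :: "'a::euclidean_space \<Rightarrow> real"
  assumes "continuous_on (- {0}) \<alpha>" "0 < \<delta>"
  obtains C where "\<And>x. \<delta> \<le> norm x \<Longrightarrow> norm x \<le> S \<Longrightarrow> norm x powr (- s) * \<alpha> x \<le> C"
proof -
  let ?K = "cball 0 S - ball 0 \<delta> :: 'a set"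
  have "continuous_on ?K (\<lambda>x. norm x powr (- s) * \<alpha> x)"
    using assms by (intro continuous_intros continuous_on_subset[OF assms(1)]) auto
  moreover have "compact ?K" by (intro compact_diff) auto
  ultimately have "bounded ((\<lambda>x. norm x powr (- s) * \<alpha> x) ` ?K)"
    by (intro compact_imp_bounded compact_continuous_image)
  then obtain C where C: "\<forall>y\<in>(\<lambda>x. norm x powr (- s) * \<alpha> x) ` ?K. norm y \<le> C"
    unfolding bounded_iff by blast
  show ?thesis
  proof (rule that)
    fix x :: 'a assume "\<delta> \<le> norm x" "norm x \<le> S"
    then have "norm (norm x powr (- s) * \<alpha> x) \<le> C" by (intro C[rule_format] imageI) simp
    then show "norm x powr (- s) * \<alpha> x \<le> C" by (simp add: abs_le_iff)
  qed
qed

lemma le_powr_of_scaled_le: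
  assumes "0 < (t::real)" "t powr (- s) * x \<le> C"
  shows "x \<le> C * t powr s"
proof -
  have "x = (t powr (- s) * x) * t powr s" using assms by (simp add: powr_minus)
  also have "\<dots> \<le> C * t powr s" using assms by (intro mult_right_mono) auto
  finally show ?thesis .
qed

lemma Limsup_less_top_bound:
  assumes "Limsup F (\<lambda>x. ereal (f x)) < \<infinity>"
  obtains C where "eventually (\<lambda>x. f x < C) F"
proof -
  obtain n :: nat where "Limsup F (\<lambda>x. ereal (f x)) < ereal (real n)"
    using assms less_PInf_Ex_of_nat by auto
  from Limsup_lessD[OF this] show ?thesis using that[of "real n"] by simp
qed

lemma coefficient_power_bounds:
  fixes \<alpha> :: "'a::euclidean_space \<Rightarrow> real"
  assumes "continuous_on (- {0}) \<alpha>"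
    and "Limsup (at 0) (\<lambda>x. ereal (norm x powr (- a) * \<alpha> x)) < \<infinity>"
    and "Limsup at_infinity (\<lambda>x. ereal (norm x powr (- b) * \<alpha> x)) < \<infinity>"
  obtains C where "0 < C" "\<And>x. x \<noteq> 0 \<Longrightarrow> norm x \<le> 1 \<Longrightarrow> \<alpha> x \<le> C * norm x powr a"
    "\<And>x. norm x \<ge> 1 \<Longrightarrow> \<alpha> x \<le> C * norm x powr b"
proof -
  obtain C1 where "eventually (\<lambda>x. norm x powr (- a) * \<alpha> x < C1) (at 0)"
    using Limsup_less_top_bound[OF assms(2)] by blast
  then obtain \<delta> where \<delta>: "0 < \<delta>" "\<And>x. x \<noteq> 0 \<Longrightarrow> norm x < \<delta> \<Longrightarrow> norm x powr (- a) * \<alpha> x < C1"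
    unfolding eventually_at by (auto simp: dist_norm)
  obtain C2 where C2: "\<And>x. \<delta> \<le> norm x \<Longrightarrow> norm x \<le> 1 \<Longrightarrow> norm x powr (- a) * \<alpha> x \<le> C2"
    using powr_weight_bounded_on_annulus[OF assms(1) \<delta>(1)] by blast
  obtain C3 where "eventually (\<lambda>x. norm x powr (- b) * \<alpha> x < C3) at_infinity"
    using Limsup_less_top_bound[OF assms(3)] by blast
  then obtain S where S: "\<And>x. S \<le> norm x \<Longrightarrow> norm x powr (- b) * \<alpha> x < C3"
    unfolding eventually_at_infinity by auto
  obtain C4 where C4: "\<And>x. 1 \<le> norm x \<Longrightarrow> norm x \<le> S \<Longrightarrow> norm x powr (- b) * \<alpha> x \<le> C4"
    using powr_weight_bounded_on_annulus[OF assms(1) zero_less_one] by blast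
  \<comment> \<open>Dominates the bounds near 0, on the two compact annuli and near infinity, and is
    positive.\<close>
  define C where "C = 1 + \<bar>C1\<bar> + \<bar>C2\<bar> + \<bar>C3\<bar> + \<bar>C4\<bar>"
  show ?thesis
  proof (rule that[of C])
    show "0 < C" by (simp add: C_def)
    show "\<alpha> x \<le> C * norm x powr a" if "x \<noteq> 0" "norm x \<le> 1" for x
    proof (rule le_powr_of_scaled_le)
      show "norm x powr (- a) * \<alpha> x \<le> C"
        using \<delta>(2)[OF that(1)] C2[of x] that(2) by (cases "norm x < \<delta>") (auto simp: C_def)
    qed (use that in simp)
    show "\<alpha> x \<le> C * norm x powr b" if "norm x \<ge> 1" for x
    proof (rule le_powr_of_scaled_le)
      show "norm x powr (- b) * \<alpha> x \<le> C"
        using S[of x] C4[of x] that by (cases "norm x \<le> S") (auto simp: C_def)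
    qed (use that in linarith)
  qed
qed

text \<open>The 3G inequality turns boundedness of the potential of \<open>\<alpha> g\<^bsup>p-1\<^esup>\<close> into a pointwise comparison of potentials.\<close>

lemma newton_op_newton_potential_le:
  fixes \<mu> :: "'a::euclidean_space measure"
  assumes "DIM('a) \<ge> 3" "radon_measure \<mu>" "1 < p"
    and [measurable]: "\<alpha> \<in> borel_measurable borel"
    and B: "\<And>x. (\<integral>\<^sup>+y. newton_kernel (x - y) * ennreal (\<alpha> y) * ennpowr (newton_potential \<mu> y) (p - 1) \<partial>lborel) \<le> ennreal B"
    and "0 \<le> B"
  shows "newton_op \<alpha> p (newton_potential \<mu>) x \<le> ennreal (2 powr (real DIM('a) - 2) * (2 * B)) * newton_potential \<mu> x"
proof -
  interpret M: sigma_finite_measure \<mu> by (rule radon_measure_sigma_finite[OF assms(2)])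
  interpret P: pair_sigma_finite "lborel :: 'a measure" \<mu> ..
  have [measurable_cong]: "sets \<mu> = sets borel" using assms(2) by (simp add: radon_measure_def)
  note [measurable] = newton_potential_measurable[OF assms(2)]
  \<comment> \<open>One factor of the potential is split off from its power \<open>p\<close>; that
    factor is then unfolded as an integral over \<mu>, and \<open>V\<close> collects the
    rest.\<close>
  define V where "V = (\<lambda>y. ennreal (\<alpha> y) * ennpowr (newton_potential \<mu> y) (p - 1))"
  have [measurable]: "V \<in> borel_measurable borel" unfolding V_def by measurable
  define D where "D = ennreal (2 powr (real DIM('a) - 2))"
  have V_bound: "(\<integral>\<^sup>+y. newton_kernel (x - y) * V y \<partial>lborel) \<le> ennreal B" for x
    using B[of x] by (simp add: V_def mult.assoc)
  have "newton_op \<alpha> p (newton_potential \<mu>) x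
    = (\<integral>\<^sup>+y. (\<integral>\<^sup>+z. newton_kernel (x - y) * V y * newton_kernel (y - z) \<partial>\<mu>) \<partial>lborel)"
    unfolding newton_op_def
  proof (intro nn_integral_cong)
    fix y
    have "ennpowr (newton_potential \<mu> y) p = ennpowr (newton_potential \<mu> y) (p - 1) * newton_potential \<mu> y"
      using ennpowr_add[of "p - 1" 1 "newton_potential \<mu> y"] \<open>1 < p\<close> by simp
    then have "newton_kernel (x - y) * ennreal (\<alpha> y) * ennpowr (newton_potential \<mu> y) p
      = newton_kernel (x - y) * V y * newton_potential \<mu> y"
      by (simp add: V_def mult.assoc)
    also have "\<dots> = (\<integral>\<^sup>+z. newton_kernel (x - y) * V y * newton_kernel (y - z) \<partial>\<mu>)"
      unfolding newton_potential_def by (subst nn_integral_cmult) simp_all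
    finally show "newton_kernel (x - y) * ennreal (\<alpha> y) * ennpowr (newton_potential \<mu> y) p
      = (\<integral>\<^sup>+z. newton_kernel (x - y) * V y * newton_kernel (y - z) \<partial>\<mu>)" .
  qed
  also have "\<dots> \<le> (\<integral>\<^sup>+y. (\<integral>\<^sup>+z. D * newton_kernel (x - z) *
      (newton_kernel (x - y) * V y + newton_kernel (z - y) * V y) \<partial>\<mu>) \<partial>lborel)"
  proof (intro nn_integral_mono)
    fix y z
    have "newton_kernel (x - y) * newton_kernel (y - z) * V y
      \<le> D * newton_kernel (x - z) * (newton_kernel (x - y) + newton_kernel (y - z)) * V y"
      unfolding D_def by (intro mult_right_mono newton_kernel_3G assms) simp
    then show "newton_kernel (x - y) * V y * newton_kernel (y - z) \<le> D * newton_kernel (x - z) *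
      (newton_kernel (x - y) * V y + newton_kernel (z - y) * V y)"
      by (simp add: newton_kernel_commute[of y z] distrib_left distrib_right mult_ac)
  qed
  also have "\<dots> = (\<integral>\<^sup>+z. (\<integral>\<^sup>+y. D * newton_kernel (x - z) *
      (newton_kernel (x - y) * V y + newton_kernel (z - y) * V y) \<partial>lborel) \<partial>\<mu>)"
    \<comment> \<open>After Tonelli the inner integrals are the potentials of \<open>V\<close> at
      \<open>x\<close> and at \<open>z\<close>.\<close>
    by (rule P.Fubini'[symmetric]) measurable
  also have "\<dots> = (\<integral>\<^sup>+z. D * newton_kernel (x - z) *
      ((\<integral>\<^sup>+y. newton_kernel (x - y) * V y \<partial>lborel) + (\<integral>\<^sup>+y. newton_kernel (z - y) * V y \<partial>lborel)) \<partial>\<mu>)"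
    by (simp add: nn_integral_cmult nn_integral_add)
  \<comment> \<open>The variable \<open>z\<close> is integrated against \<mu>, which may charge
    Lebesgue null sets, so the bound \<open>B\<close> has to hold at every point.\<close>
  also have "\<dots> \<le> (\<integral>\<^sup>+z. D * newton_kernel (x - z) * (ennreal B + ennreal B) \<partial>\<mu>)"
    by (intro nn_integral_mono mult_left_mono add_mono V_bound) auto
  also have "\<dots> = (\<integral>\<^sup>+z. (D * (ennreal B + ennreal B)) * newton_kernel (x - z) \<partial>\<mu>)"
    by (simp add: mult_ac)
  also have "\<dots> = (D * (ennreal B + ennreal B)) * newton_potential \<mu> x"
    unfolding newton_potential_def by (rule nn_integral_cmult) measurable
  also have "D * (ennreal B + ennreal B) = ennreal (2 powr (real DIM('a) - 2) * (2 * B))"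
    using \<open>0 \<le> B\<close> by (simp add: D_def ennreal_mult flip: ennreal_plus)
  finally show ?thesis .
qed

lemma newton_op_cmult:
  assumes [measurable]: "\<alpha> \<in> borel_measurable borel" "u \<in> borel_measurable borel" and "0 < p" "0 \<le> t"
  shows "newton_op \<alpha> p (\<lambda>y. ennreal t * u y) x = ennreal (t powr p) * newton_op \<alpha> p u x"
proof -
  have "newton_op \<alpha> p (\<lambda>y. ennreal t * u y) x
    = (\<integral>\<^sup>+y. ennreal (t powr p) * (newton_kernel (x - y) * ennreal (\<alpha> y) * ennpowr (u y) p) \<partial>lborel)"
    unfolding newton_op_def using assms(3,4) by (simp add: ennpowr_mult ennpowr_ennreal mult_ac)
  also have "\<dots> = ennreal (t powr p) * newton_op \<alpha> p u x"
    unfolding newton_op_def by (rule nn_integral_cmult) measurable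
  finally show ?thesis .
qed

text \<open>Half of \<open>2 * \<kappa>\<close> times the potential pays for the source, the other
  half for the nonlinear term, which is at most \<open>(2 * \<kappa>) powr p * D\<close> times the
  potential. The threshold gives \<open>(2 * \<kappa>) powr p * D \<le> \<kappa>\<close>; writing
  \<open>D + 1\<close> keeps its denominator positive.\<close>

lemma multiple_of_potential_supersolution:
  fixes \<mu> :: "'a::euclidean_space measure"
  assumes "radon_measure \<mu>" "1 < p" "\<alpha> \<in> borel_measurable borel" "0 \<le> D"
    and D: "\<And>x. newton_op \<alpha> p (newton_potential \<mu>) x \<le> ennreal D * newton_potential \<mu> x"
    and \<kappa>: "0 < \<kappa>" "\<kappa> \<le> (1 / (2 powr p * (D + 1))) powr (1 / (p - 1))"
  shows "newton_op \<alpha> p (\<lambda>y. ennreal (2 * \<kappa>) * newton_potential \<mu> y) x + ennreal \<kappa> * newton_potential \<mu> x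
    \<le> ennreal (2 * \<kappa>) * newton_potential \<mu> x"
proof -
  have "\<kappa> powr (p - 1) \<le> ((1 / (2 powr p * (D + 1))) powr (1 / (p - 1))) powr (p - 1)"
    using \<kappa> assms(2) by (intro powr_mono2) auto
  also have "\<dots> = 1 / (2 powr p * (D + 1))"
    using assms(2,4) by (simp add: powr_powr)
  finally have "\<kappa> powr (p - 1) \<le> 1 / (2 powr p * (D + 1))" .
  moreover have "0 < 2 powr p * (D + 1)" using assms(4) by simp
  ultimately have "2 powr p * (D + 1) * \<kappa> powr (p - 1) \<le> 1"
    by (simp only: pos_le_divide_eq mult.commute)
  moreover have "2 powr p * D * \<kappa> powr (p - 1) \<le> 2 powr p * (D + 1) * \<kappa> powr (p - 1)"
    using assms(4) by (intro mult_right_mono mult_left_mono) auto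
  ultimately have "2 powr p * D * \<kappa> powr (p - 1) \<le> 1" by (rule order_trans[rotated])
  then have "2 powr p * D * \<kappa> powr (p - 1) * \<kappa> \<le> 1 * \<kappa>"
    using \<kappa> by (intro mult_right_mono) auto
  moreover have "\<kappa> powr p = \<kappa> powr (p - 1) * \<kappa>"
    using \<kappa> powr_add[of \<kappa> "p - 1" 1] by simp
  ultimately have le: "(2 * \<kappa>) powr p * D \<le> \<kappa>"
    by (simp add: powr_mult mult_ac)
  have "newton_op \<alpha> p (\<lambda>y. ennreal (2 * \<kappa>) * newton_potential \<mu> y) x
    = ennreal ((2 * \<kappa>) powr p) * newton_op \<alpha> p (newton_potential \<mu>) x"
    using assms(2,3) \<kappa> newton_potential_measurable[OF assms(1)] by (intro newton_op_cmult) auto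
  also have "\<dots> \<le> ennreal ((2 * \<kappa>) powr p) * (ennreal D * newton_potential \<mu> x)"
    by (intro mult_left_mono D) simp
  also have "\<dots> = ennreal ((2 * \<kappa>) powr p * D) * newton_potential \<mu> x"
    using assms(4) by (simp add: ennreal_mult mult.assoc)
  also have "\<dots> \<le> ennreal \<kappa> * newton_potential \<mu> x"
    by (intro mult_right_mono ennreal_leI le) simp
  finally have "newton_op \<alpha> p (\<lambda>y. ennreal (2 * \<kappa>) * newton_potential \<mu> y) x + ennreal \<kappa> * newton_potential \<mu> x
    \<le> ennreal \<kappa> * newton_potential \<mu> x + ennreal \<kappa> * newton_potential \<mu> x"
    by (rule add_right_mono)
  also have "\<dots> = ennreal (2 * \<kappa>) * newton_potential \<mu> x"
    using \<kappa> by (simp flip: distrib_right ennreal_plus)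
  finally show ?thesis .
qed

section \<open>The threshold as the supremum of the admissible parameters\<close>

theorem theorem1p1:
  fixes \<alpha> :: "'a::euclidean_space \<Rightarrow> real"
    and \<mu> :: "'a measure"
    and a b c d p :: real
    and r :: ereal
  assumes "DIM('a) \<ge> 3"
    and "continuous_on (- {0}) \<alpha>"
    and "\<And>x. x \<noteq> 0 \<Longrightarrow> \<alpha> x > 0"
    and "Limsup (at 0) (\<lambda>x. ereal (norm x powr (- a) * \<alpha> x)) < \<infinity>"
    and "Limsup at_infinity (\<lambda>x. ereal (norm x powr (- b) * \<alpha> x)) < \<infinity>"
    and "a > -2"
    and "1 < p" and "ereal p < r"
    and "p > (real DIM('a) + b) / (real DIM('a) - 2)"
    and "r > ereal (real DIM('a) * (p - 1) / 2)"
    and "c > - (a + 2) / (p - 1)"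
    and "d < - (b + 2) / (p - 1)"
    and "radon_measure \<mu>"
    and "emeasure \<mu> (space \<mu>) \<noteq> 0"
    and "(\<lambda>x. enn2ereal (newton_potential \<mu> x)) \<in> weighted_Lq r c d"
  shows "\<exists>\<kappa>_up::real. \<kappa>_up > 0 \<and>
    (\<forall>\<kappa>. 0 < \<kappa> \<and> \<kappa> < \<kappa>_up \<longrightarrow> (\<exists>u. is_minimal_solution \<alpha> p \<mu> \<kappa> u)) \<and>
    (\<forall>\<kappa>. \<kappa> > \<kappa>_up \<longrightarrow> \<not> (\<exists>u. is_solution \<alpha> p \<mu> \<kappa> u)) \<and>
    (\<exists>\<kappa>_low. 0 < \<kappa>_low \<and> \<kappa>_low \<le> \<kappa>_up \<and>
      (\<forall>\<kappa>. 0 < \<kappa> \<and> \<kappa> < \<kappa>_low \<longrightarrow>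
        (\<forall>u. is_minimal_solution \<alpha> p \<mu> \<kappa> u \<longrightarrow>
          (\<lambda>x. enn2ereal (u x)) \<in> weighted_Lq r (min c 0) (max d (2 - real DIM('a))))))"
proof -
  note dim = assms(1) and pos = assms(3) and p = assms(7) and radon = assms(13) and nontriv = assms(14)
  define g where "g = newton_potential \<mu>"
  have \<alpha>_meas [measurable]: "\<alpha> \<in> borel_measurable borel"
    using assms(2) by (intro borel_measurable_continuous_countable_exceptions[of "{0}"]) auto
  have g_meas [measurable]: "g \<in> borel_measurable borel"
    unfolding g_def by (rule newton_potential_measurable[OF radon])
  obtain C where C: "0 < C" "\<And>x. x \<noteq> 0 \<Longrightarrow> norm x \<le> 1 \<Longrightarrow> \<alpha> x \<le> C * norm x powr a"
    "\<And>x. norm x \<ge> 1 \<Longrightarrow> \<alpha> x \<le> C * norm x powr b"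
    using coefficient_power_bounds[OF assms(2,4,5)] by blast
  \<comment> \<open>The possibly infinite \<open>r\<close> is replaced by a finite \<rho> above both
    lower bounds; the annulus estimates are then used with \<open>q = p - 1\<close>.\<close>
  have "ereal (max p (real DIM('a) * (p - 1) / 2)) < r" "0 \<le> max p (real DIM('a) * (p - 1) / 2)"
    using assms(7,8,10) by (auto simp: max_def)
  then obtain \<rho> M where \<rho>: "max p (real DIM('a) * (p - 1) / 2) < \<rho>" "0 \<le> M"
    "\<And>R. 0 < R \<Longrightarrow> (\<integral>\<^sup>+y. ennpowr (g y) \<rho> * indicator (annulus R) y \<partial>lborel)
        \<le> ennreal (M * R ^ DIM('a) * weight c d R powr \<rho>)"
    using weighted_Lq_annulus_bound[OF assms(15), folded g_def] by blast
  have exps: "0 < a + 2 + c * (p - 1)" "b + 2 + d * (p - 1) < 0"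
    using assms(11,12) p by (auto simp: field_simps)
  obtain B where B: "B \<ge> 0"
    "\<And>x. (\<integral>\<^sup>+y. newton_kernel (x - y) * ennreal (\<alpha> y) * ennpowr (g y) (p - 1) \<partial>lborel) \<le> ennreal B"
    using newton_potential_weighted_bounded[OF dim _ _ _ \<rho>(2) C(1) \<alpha>_meas g_meas C(2,3) \<rho>(3) exps] \<rho>(1) p
    by auto
  \<comment> \<open>The weighted potential is finite at the origin, so its integrand is finite a.e.;
    away from 0 the kernel and \<alpha> are positive, which forces \<open>g\<close> to be
    finite.\<close>
  have g_fin: "AE y in lborel. g y < \<infinity>"
  proof -
    have "AE y in lborel. newton_kernel (0 - y) * ennreal (\<alpha> y) * ennpowr (g y) (p - 1) \<noteq> \<infinity>"
      using B(2)[of 0] by (intro nn_integral_PInf_AE) (auto simp: top_unique)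
    moreover have "AE y in lborel. y \<noteq> (0::'a)" by (rule AE_lborel_singleton)
    ultimately show ?thesis
    proof eventually_elim
      case (elim y)
      obtain K where "K > 0" "\<And>x::'a. x \<noteq> 0 \<Longrightarrow> newton_kernel x = ennreal (K * norm x powr (2 - real DIM('a)))"
        using newton_kernel_formula[OF dim] by metis
      then have "newton_kernel (0 - y) \<noteq> 0" using elim(2) by (simp add: not_le)
      then show ?case
        using elim(1) pos[OF elim(2)] by (cases "g y") (auto simp: ennreal_mult_eq_top_iff)
    qed
  qed
  define D where "D = 2 powr (real DIM('a) - 2) * (2 * B)"
  have D: "0 \<le> D" "\<And>x. newton_op \<alpha> p g x \<le> ennreal D * g x"
    using newton_op_newton_potential_le[OF dim radon p \<alpha>_meas B(2)[unfolded g_def] B(1)] B(1)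
    by (auto simp: g_def D_def)
  \<comment> \<open>The bound \<open>1 / 2\<close> ensures \<open>2 * \<kappa> \<le> 1\<close>, so
    that the supersolution lies below \<open>g\<close> itself.\<close>
  define \<kappa>0 where "\<kappa>0 = min (1 / 2) ((1 / (2 powr p * (D + 1))) powr (1 / (p - 1)))"
  have \<kappa>0: "0 < \<kappa>0" using D(1) by (simp add: \<kappa>0_def add_nonneg_pos)
  have small: "\<exists>u. is_minimal_solution \<alpha> p \<mu> \<kappa> u \<and> (AE x in lborel. u x \<le> g x)"
    if \<kappa>: "0 < \<kappa>" "\<kappa> \<le> \<kappa>0" for \<kappa>
  proof -
    have "newton_op \<alpha> p (\<lambda>y. ennreal (2 * \<kappa>) * newton_potential \<mu> y) x + ennreal \<kappa> * newton_potential \<mu> x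
      \<le> ennreal (2 * \<kappa>) * newton_potential \<mu> x" for x
      using \<kappa> by (intro multiple_of_potential_supersolution[OF radon p \<alpha>_meas D(1) D(2)[unfolded g_def]])
        (auto simp: \<kappa>0_def)
    moreover have "AE x in lborel. ennreal (2 * \<kappa>) * newton_potential \<mu> x < \<infinity>"
      using g_fin by eventually_elim (simp add: g_def ennreal_mult_less_top)
    ultimately obtain u where u: "is_minimal_solution \<alpha> p \<mu> \<kappa> u"
      "AE x in lborel. u x \<le> ennreal (2 * \<kappa>) * newton_potential \<mu> x"
      using minimal_solution_below_supersolution[OF dim radon nontriv \<alpha>_meas p \<kappa>(1),
          of "\<lambda>x. ennreal (2 * \<kappa>) * newton_potential \<mu> x"] by blast
    have "ennreal (2 * \<kappa>) \<le> 1" using \<kappa> by (auto simp: \<kappa>0_def ennreal_le_1)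
    then have "ennreal (2 * \<kappa>) * g x \<le> g x" for x
      using mult_right_mono[of "ennreal (2 * \<kappa>)" 1 "g x"] by simp
    then have "AE x in lborel. u x \<le> g x"
      using u(2) unfolding g_def by (auto elim!: eventually_mono intro: order_trans)
    then show ?thesis using u(1) by blast
  qed
  define S where "S = {\<kappa>. 0 < \<kappa> \<and> (\<exists>u. is_solution \<alpha> p \<mu> \<kappa> u)}"
  obtain K where K: "\<And>\<kappa> u. 0 < \<kappa> \<Longrightarrow> is_solution \<alpha> p \<mu> \<kappa> u \<Longrightarrow> \<kappa> \<le> K"
    using solution_scale_bound[OF dim radon nontriv assms(2) pos p] by blast
  have S_bdd: "bdd_above S" unfolding S_def bdd_above_def using K by auto
  have "\<kappa>0 \<in> S" using small[OF \<kappa>0 order_refl] \<kappa>0 by (auto simp: S_def is_minimal_solution_def)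
  then have up: "\<kappa>0 \<le> Sup S" "S \<noteq> {}" using S_bdd by (auto intro: cSup_upper)
  have "0 < Sup S" using up \<kappa>0 by linarith
  moreover have "\<forall>\<kappa>. 0 < \<kappa> \<and> \<kappa> < Sup S \<longrightarrow> (\<exists>u. is_minimal_solution \<alpha> p \<mu> \<kappa> u)"
  proof (intro allI impI)
    show "\<exists>u. is_minimal_solution \<alpha> p \<mu> \<kappa> u" if \<kappa>: "0 < \<kappa> \<and> \<kappa> < Sup S" for \<kappa>
    proof -
      obtain \<kappa>' where "\<kappa>' \<in> S" "\<kappa> < \<kappa>'"
        using \<kappa> less_cSupE[OF _ up(2), of \<kappa>] by blast
      then obtain v where v: "\<kappa> < \<kappa>'" "is_solution \<alpha> p \<mu> \<kappa>' v"
        by (auto simp: S_def)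
      have "AE x in lborel. newton_op \<alpha> p v x + ennreal \<kappa> * newton_potential \<mu> x \<le> v x"
      proof -
        have "AE x in lborel. v x = newton_op \<alpha> p v x + ennreal \<kappa>' * newton_potential \<mu> x"
          using v(2) by (simp add: is_solution_iff)
        then show ?thesis
        proof eventually_elim
          case (elim x)
          have "ennreal \<kappa> * newton_potential \<mu> x \<le> ennreal \<kappa>' * newton_potential \<mu> x"
            using v(1) by (intro mult_right_mono ennreal_leI) auto
          then have "newton_op \<alpha> p v x + ennreal \<kappa> * newton_potential \<mu> x
            \<le> newton_op \<alpha> p v x + ennreal \<kappa>' * newton_potential \<mu> x"
            by (rule add_left_mono)
          with elim show ?case by simp
        qed
      qed
      moreover have "AE x in lborel. v x < \<infinity>"
        using v(2) by (auto simp: is_solution_iff elim!: eventually_mono)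
      ultimately show ?thesis
        using minimal_solution_below_supersolution[OF dim radon nontriv \<alpha>_meas p, of \<kappa> v] \<kappa> by blast
    qed
  qed
  moreover have "\<forall>\<kappa>. \<kappa> > Sup S \<longrightarrow> \<not> (\<exists>u. is_solution \<alpha> p \<mu> \<kappa> u)"
  proof (intro allI impI)
    show "\<not> (\<exists>u. is_solution \<alpha> p \<mu> \<kappa> u)" if "\<kappa> > Sup S" for \<kappa>
    proof
      assume "\<exists>u. is_solution \<alpha> p \<mu> \<kappa> u"
      \<comment> \<open>Membership needs \<open>0 < \<kappa>\<close>, which follows from
        \<open>\<kappa> > Sup S \<ge> \<kappa>0\<close>.\<close>
      then have "\<kappa> \<in> S" using that up \<kappa>0 by (auto simp: S_def)
      then have "\<kappa> \<le> Sup S" using S_bdd by (rule cSup_upper)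
      then show False using that by simp
    qed
  qed
  moreover have "\<exists>\<kappa>_low. 0 < \<kappa>_low \<and> \<kappa>_low \<le> Sup S \<and>
    (\<forall>\<kappa>. 0 < \<kappa> \<and> \<kappa> < \<kappa>_low \<longrightarrow>
      (\<forall>u. is_minimal_solution \<alpha> p \<mu> \<kappa> u \<longrightarrow>
        (\<lambda>x. enn2ereal (u x)) \<in> weighted_Lq r (min c 0) (max d (2 - real DIM('a)))))"
  proof (intro exI[of _ \<kappa>0] conjI allI impI)
    show "0 < \<kappa>0" "\<kappa>0 \<le> Sup S" by (fact \<kappa>0 up(1))+
    show "(\<lambda>x. enn2ereal (u x)) \<in> weighted_Lq r (min c 0) (max d (2 - real DIM('a)))"
      if \<kappa>: "0 < \<kappa> \<and> \<kappa> < \<kappa>0" and u: "is_minimal_solution \<alpha> p \<mu> \<kappa> u" for \<kappa> u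
    proof -
      \<comment> \<open>The claim concerns every minimal solution \<open>u\<close>; minimality
        places it below the one constructed under \<open>g\<close>.\<close>
      obtain w where w: "is_minimal_solution \<alpha> p \<mu> \<kappa> w" "AE x in lborel. w x \<le> g x"
        using small[of \<kappa>] \<kappa> by auto
      have "AE x in lborel. u x \<le> w x"
        using u w(1) by (simp add: is_minimal_solution_def AE_completion_iff)
      with w(2) have "AE x in lborel. u x \<le> g x" by eventually_elim (rule order_trans)
      moreover have "u \<in> borel_measurable lebesgue"
        using u by (simp add: is_minimal_solution_def is_solution_def)
      moreover have "0 < r" using p assms(8) by (auto intro: less_trans[of 0 "ereal p"])
      ultimately show ?thesis
        using weighted_Lq_mono[OF _ _ _ min.cobounded1 max.cobounded1 assms(15)] by (simp add: g_def)
    qed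
  qed
  ultimately show ?thesis by (rule exI[of _ "Sup S", OF conjI[OF _ conjI[OF _ conjI]]])
qed

end
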